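(* The monoid ${\cal RM}_2^{\sf P}$ (under composition of partial functions) is not finitely generated.
   Context: Let $A=\{0,1\}$, let $A^*$ be the set of all finite words over $A$, and let $|x|$ denote the length of $x\in A^*$. "Function" means partial function; ${\sf Dom}(f)$ is the set of $x$ for which $f(x)$ is defined. A partial function $f:A^*\to A^*$ is polynomially balanced iff there exist polynomials $p,q$ such that for all $x\in{\sf Dom}(f)$: $|f(x)|\le p(|x|)$ and $|x|\le q(|f(x)|)$. ${\sf fP}$ is the set of partial functions $f:A^*\to A^*$ that are polynomially balanced and computable by a deterministic polynomial-time Turing machine (so in particular ${\sf Dom}(f)\in{\sf P}$); it is a monoid under composition. A right-ideal morphism of $A^*$ is a partial function $h:A^*\to A^*$ such that for all $x\in{\sf Dom}(h)$ and all $w\in A^*$, $xw\in{\sf Dom}(h)$ and $h(xw)=h(x)\,w$. ${\cal RM}_2^{\sf P}$ is the submonoid $\{f\in{\sf fP}: f \text{ is a right-ideal morphism of }A^*\}$ of ${\sf fP}$. *)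

theory Defs
  imports "HOL-Algebra.Group" "HOL-Computational_Algebra.Polynomial"
begin

type_synonym word = "bool list"

text \<open>
  \<open>Letter False\<close> and \<open>Letter True\<close> are the letters 0 and 1; each machine may use finitely many
  of the symbols \<open>Aux i\<close> as additional work symbols.
\<close>

datatype symbol = Blank | Letter bool | Aux nat

datatype move = MoveLeft | Stay | MoveRight

text \<open>
  A tape is two-way infinite. It is given by the position of its head and its contents.
\<close>

type_synonym tape = "int \<times> (int \<Rightarrow> symbol)"

record 'q tm =
  ntapes :: nat
  states :: "'q set"
  alphabet :: "symbol set"
  start :: 'q
  accept :: 'q
  reject :: 'q
  delta :: "'q \<Rightarrow> symbol list \<Rightarrow> 'q \<times> (symbol \<times> move) list"

definition wf_tm :: "'q tm \<Rightarrow> bool" where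
  "wf_tm M \<longleftrightarrow>
     ntapes M \<ge> 1 \<and> finite (states M) \<and> finite (alphabet M) \<and>
     Blank \<in> alphabet M \<and> range Letter \<subseteq> alphabet M \<and>
     start M \<in> states M \<and> accept M \<in> states M \<and> reject M \<in> states M \<and> accept M \<noteq> reject M \<and>
     (\<forall>q \<in> states M. \<forall>ss. length ss = ntapes M \<and> set ss \<subseteq> alphabet M \<longrightarrow>
        (case delta M q ss of (q', as) \<Rightarrow>
           q' \<in> states M \<and> length as = ntapes M \<and> fst ` set as \<subseteq> alphabet M))"

fun offset :: "move \<Rightarrow> int" where
  "offset MoveLeft = -1"
| "offset Stay = 0"
| "offset MoveRight = 1"

fun act :: "symbol \<times> move \<Rightarrow> tape \<Rightarrow> tape" where
  "act (s, m) (h, c) = (h + offset m, c(h := s))"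

type_synonym 'q config = "'q \<times> tape list"

fun step :: "'q tm \<Rightarrow> 'q config \<Rightarrow> 'q config" where
  "step M (q, ts) =
     (if q = accept M \<or> q = reject M then (q, ts)
      else case delta M q (map (\<lambda>(h, c). c h) ts) of (q', as) \<Rightarrow> (q', map2 act as ts))"

definition word_contents :: "word \<Rightarrow> int \<Rightarrow> symbol" where
  "word_contents x i = (if 0 \<le> i \<and> i < int (length x) then Letter (x ! nat i) else Blank)"

definition init_config :: "'q tm \<Rightarrow> word \<Rightarrow> 'q config" where
  "init_config M x =
     (start M, (0, word_contents x) # replicate (ntapes M - 1) (0, word_contents []))"

text \<open>
  The input is on the first tape and the output on the last one (the same tape if there is only
  one), written from cell 0 on and with all other cells blank. A machine computing a partial
  function halts on all inputs within the time bound: it accepts with the value on the output tape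
  if the function is defined, and rejects otherwise. In particular it decides the domain.
\<close>

definition computes_in_time :: "'q tm \<Rightarrow> (nat \<Rightarrow> nat) \<Rightarrow> (word \<rightharpoonup> word) \<Rightarrow> bool" where
  "computes_in_time M T f \<longleftrightarrow>
     (\<forall>x. \<exists>t \<le> T (length x). case (step M ^^ t) (init_config M x) of (q, ts) \<Rightarrow>
        (case f x of
           None \<Rightarrow> q = reject M
         | Some y \<Rightarrow> q = accept M \<and> snd (last ts) = word_contents y))"

text \<open>
  States are natural numbers, since one cannot quantify over types; as the state set is finite,
  this is no restriction.
\<close>

definition polytime_computable :: "(word \<rightharpoonup> word) \<Rightarrow> bool" where
  "polytime_computable f \<longleftrightarrow>
     (\<exists>(M :: nat tm) (p :: nat poly). wf_tm M \<and> computes_in_time M (poly p) f)"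

text \<open>
  Polynomials with natural coefficients suffice as bounds: every real polynomial is dominated by
  such a polynomial on the natural numbers.
\<close>

definition polynomially_balanced :: "(word \<rightharpoonup> word) \<Rightarrow> bool" where
  "polynomially_balanced f \<longleftrightarrow>
     (\<exists>(p :: nat poly) (q :: nat poly). \<forall>x y. f x = Some y \<longrightarrow>
        length y \<le> poly p (length x) \<and> length x \<le> poly q (length y))"

definition fP :: "(word \<rightharpoonup> word) set" where
  "fP = {f. polynomially_balanced f \<and> polytime_computable f}"

definition right_ideal_morphism :: "(word \<rightharpoonup> word) \<Rightarrow> bool" where
  "right_ideal_morphism h \<longleftrightarrow> (\<forall>x y w. h x = Some y \<longrightarrow> h (x @ w) = Some (y @ w))"

definition RM2P :: "(word \<rightharpoonup> word) monoid" where
  "RM2P = \<lparr>carrier = {f \<in> fP. right_ideal_morphism f}, monoid.mult = (\<circ>\<^sub>m), one = Some\<rparr>"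

text \<open>The constant \<open>generate\<close> of HOL-Algebra also closes under inverses.\<close>

inductive_set monoid_generate :: "('a, 'b) monoid_scheme \<Rightarrow> 'a set \<Rightarrow> 'a set"
  for G (structure) and S where
  one: "\<one> \<in> monoid_generate G S"
| incl: "s \<in> S \<Longrightarrow> s \<in> monoid_generate G S"
| mult: "a \<in> monoid_generate G S \<Longrightarrow> b \<in> monoid_generate G S \<Longrightarrow> a \<otimes> b \<in> monoid_generate G S"

definition finitely_generated_monoid :: "('a, 'b) monoid_scheme \<Rightarrow> bool" where
  "finitely_generated_monoid G \<longleftrightarrow>
     (\<exists>S. finite S \<and> S \<subseteq> carrier G \<and> monoid_generate G S = carrier G)"

end

theory Submission
  imports Defs "HOL-Library.Sublist"
begin

text \<open>
  Let \<open>gs\<close> be a finite list of elements of the monoid. The claim is that some function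
  \<open>diagonal gs\<close> of the monoid is not a composition of entries of \<open>gs\<close>; this is a diagonal
  argument. Compositions are written as programs, and programs are coded as words. A word \<open>x\<close> is
  used as a program and as the datum of that program at the same time: \<open>diagonal gs\<close> is the
  identity on the right ideal generated by those \<open>x\<close> for which the run of the program at the
  beginning of \<open>x\<close> on the datum \<open>x\<close> reaches a generator that is undefined at its argument while
  all values met before had length at most \<open>2 * length x\<close>.

  The bound on the lengths is what makes this function computable in polynomial time. A composition
  of \<open>k\<close> generators may need time \<open>n ^ (d ^ k)\<close>, with no bound on \<open>k\<close>, so one cannot afford
  to run arbitrary programs; but if all values stay short, each of the at most \<open>length x\<close> calls
  costs a fixed polynomial. In general such a bound would ruin the diagonal argument, because a
  program could begin with a call that pads its datum. Here right-ideal morphisms help. On a ray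
  \<open>y\<close>, \<open>y0\<close>, \<open>y00\<close>, and so on, a generator is either undefined everywhere or it sends all sufficiently
  late points of the ray to a ray again, because it copies the zeros that come after the first
  point where it is defined. So for a fixed program all values met at the point \<open>y\<close> followed by \<open>s\<close> zeros
  have length at most \<open>s\<close> plus a constant, and for large \<open>s\<close> the bound is respected
  (\<open>eventually_escape\<close>).

  Suppose now that \<open>diagonal gs\<close> is the composition coded by \<open>e\<close>, and look at the ray that starts
  in \<open>e\<close>. If the function is undefined on the whole ray, then the bounded run detects this at
  some late point, and \<open>diagonal gs\<close> is defined there by its definition. If it is defined
  somewhere on the ray, this is due to a prefix \<open>x\<close> of that point at which the composition is
  undefined; but \<open>diagonal gs\<close> is defined at \<open>x\<close>. Both cases are absurd
  (\<open>diagonal_not_pipeline\<close>).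

  The larger part of the text constructs a Turing machine for \<open>diagonal gs\<close>
  (\<open>decide_computes_diagonal\<close>). Machines are put together by \<open>branch\<close> and \<open>loop\<close> from machines
  with a single working state. The given machines of the generators are used as subroutines. As
  they are called again and again on the same tapes, which they leave in an unknown state, a mark is
  written on a separate tape in each of their steps; these marks tell how far one has to go from
  the final head positions in order to read the result and to erase everything.
\<close>

section \<open>Programs over a finite list of partial functions\<close>

text \<open>
  Reads one instruction from the front of a program, with the rest of the program as second
  component. The instruction \<open>1\<^sup>i0\<close> selects the entry at position \<open>i\<close>. If the list has length
  \<open>m\<close>, then \<open>1\<^sup>m\<close> marks the end of the program. The value \<open>None\<close> stands for this end marker as well as for
  a word that stops too early.
\<close>

fun decode :: "'g list \<Rightarrow> word \<Rightarrow> ('g \<times> word) option" where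
  "decode [] p = None"
| "decode (g # gs) [] = None"
| "decode (g # gs) (False # p) = Some (g, p)"
| "decode (g # gs) (True # p) = decode gs p"

lemma decode_length: "decode gs p = Some (g, p') \<Longrightarrow> length p' < length p"
  by (induction gs p rule: decode.induct) auto

lemma decode_mem: "decode gs p = Some (g, p') \<Longrightarrow> g \<in> set gs"
  by (induction gs p rule: decode.induct) auto

text \<open>
  The value is \<open>False\<close> when the program ends and also when a value gets too long. Thus \<open>True\<close> means
  that the program is undefined at \<open>d\<close> and that this can be found out cheaply.
\<close>

function escape :: "(word \<rightharpoonup> word) list \<Rightarrow> nat \<Rightarrow> word \<Rightarrow> word \<Rightarrow> bool" where
  "escape gs B p d =
     (case decode gs p of
        None \<Rightarrow> False
      | Some (g, p') \<Rightarrow>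
          (case g d of None \<Rightarrow> True | Some d' \<Rightarrow> length d' \<le> B \<and> escape gs B p' d'))"
  by pat_completeness auto
termination
  by (relation "measure (\<lambda>(gs, B, p, d). length p)") (auto dest: decode_length)

declare escape.simps [simp del]

text \<open>
  Ranging over all prefixes makes the domain a right ideal. The bound has to exceed \<open>length x\<close> by more
  than any constant as \<open>x\<close> grows along a ray; twice the length is enough.
\<close>

definition diagonal :: "(word \<rightharpoonup> word) list \<Rightarrow> word \<rightharpoonup> word" where
  "diagonal gs z = (if \<exists>x. prefix x z \<and> escape gs (2 * length x) x x then Some z else None)"

fun pipeline :: "(word \<rightharpoonup> word) list \<Rightarrow> word \<rightharpoonup> word" where
  "pipeline [] = Some"
| "pipeline (g # w) = pipeline w \<circ>\<^sub>m g"

lemma pipeline_append: "pipeline (u @ v) = pipeline v \<circ>\<^sub>m pipeline u"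
  by (induction u) (auto simp: map_comp_def fun_eq_iff split: option.splits)

text \<open>
  The end marker makes the run of the coded program independent of the word that follows the code.
\<close>

definition encode :: "nat \<Rightarrow> nat list \<Rightarrow> word" where
  "encode m w = concat (map (\<lambda>i. replicate i True @ [False]) w) @ replicate m True"

lemma decode_code_word: "i < length gs \<Longrightarrow> decode gs (replicate i True @ False # p) = Some (gs ! i, p)"
proof (induction i arbitrary: gs)
  case 0
  then show ?case by (cases gs) auto
next
  case (Suc i)
  then show ?case by (cases gs) auto
qed

lemma decode_end: "decode gs (replicate (length gs) True @ p) = None"
  by (induction gs) auto

lemma decode_prefix: "prefix p q \<Longrightarrow> decode gs p = Some (g, p') \<Longrightarrow> \<exists>q'. decode gs q = Some (g, q') \<and> prefix p' q'"
  by (induction gs p arbitrary: q rule: decode.induct) (auto simp: prefix_def)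

text \<open>
  A truncated program may escape as well. This does no harm: if the first few functions of a
  composition are undefined at \<open>d\<close>, so is the composition.
\<close>

lemma escape_encode_imp_undefined:
  assumes "escape gs B p d" "prefix p (encode (length gs) w @ u)" "set w \<subseteq> {..<length gs}"
  shows "pipeline (map ((!) gs) w) d = None"
  using assms
proof (induction w arbitrary: p d)
  case Nil
  then have "decode gs p = None"
    using decode_prefix[of p "replicate (length gs) True @ u" gs] decode_end[of gs u]
    by (cases "decode gs p") (auto simp: encode_def)
  with Nil(1) show ?case by (simp add: escape.simps)
next
  case (Cons i w)
  from Cons.prems(1) obtain g p' where dec: "decode gs p = Some (g, p')"
    by (auto simp: escape.simps[of gs B p d] split: option.splits)
  have "decode gs (encode (length gs) (i # w) @ u) = Some (gs ! i, encode (length gs) w @ u)"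
    using Cons.prems(3) decode_code_word by (auto simp: encode_def)
  with decode_prefix[OF Cons.prems(2) dec] have g: "g = gs ! i" and p': "prefix p' (encode (length gs) w @ u)"
    by auto
  show ?case
  proof (cases "g d")
    case None
    then show ?thesis by (simp add: g)
  next
    case (Some d')
    with Cons.prems(1) dec have "escape gs B p' d'"
      by (auto simp: escape.simps[of gs B p d])
    from Cons.IH[OF this p'] Cons.prems(3) Some show ?thesis by (simp add: g)
  qed
qed

text \<open>
  If the first function is defined at some point of the ray from \<open>y\<close>, it maps the rest of the ray to
  the ray from some \<open>z\<close>, to which the induction hypothesis applies. Each function of the composition
  thus only changes the constant \<open>C\<close> by which lengths exceed \<open>s\<close>.
\<close>

lemma eventually_escape:
  assumes "set w \<subseteq> {..<length gs}" "\<And>g. g \<in> set gs \<Longrightarrow> right_ideal_morphism g"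
    and "\<And>s. pipeline (map ((!) gs) w) (y @ replicate s False) = None"
  shows "\<exists>C. \<forall>s\<ge>C. \<forall>B\<ge>C + s. \<forall>u.
    escape gs B (encode (length gs) w @ u) (y @ replicate s False)"
  using assms(1,3)
proof (induction w arbitrary: y)
  case Nil
  then show ?case by simp
next
  case (Cons i w)
  have dec: "decode gs (encode (length gs) (i # w) @ u) = Some (gs ! i, encode (length gs) w @ u)" for u
    using Cons.prems(1) decode_code_word by (auto simp: encode_def)
  show ?case
  proof (cases "\<exists>s. (gs ! i) (y @ replicate s False) \<noteq> None")
    case False
    then show ?thesis by (auto simp: escape.simps[of gs _ "encode (length gs) (i # w) @ _"] dec)
  next
    case True
    then obtain a z where az: "(gs ! i) (y @ replicate a False) = Some z" by auto
    have val: "(gs ! i) (y @ replicate (a + r) False) = Some (z @ replicate r False)" for r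
    proof -
      have "right_ideal_morphism (gs ! i)" using assms(2) Cons.prems(1) by simp
      with az have "(gs ! i) ((y @ replicate a False) @ replicate r False) = Some (z @ replicate r False)"
        unfolding right_ideal_morphism_def by blast
      then show ?thesis by (simp add: replicate_add)
    qed
    have "pipeline (map ((!) gs) w) (z @ replicate r False) = None" for r
      using Cons.prems(2)[of "a + r"] by (simp add: val)
    with Cons.IH[of z] Cons.prems(1) have "\<exists>C. \<forall>s\<ge>C. \<forall>B\<ge>C + s. \<forall>u.
        escape gs B (encode (length gs) w @ u) (z @ replicate s False)"
      by simp
    then obtain C where
      C: "\<And>s B u. s \<ge> C \<Longrightarrow> B \<ge> C + s \<Longrightarrow> escape gs B (encode (length gs) w @ u) (z @ replicate s False)"
      by blast
    have "escape gs B (encode (length gs) (i # w) @ u) (y @ replicate s False)"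
      if "s \<ge> a + C + length z" "B \<ge> a + C + length z + s" for s B u
    proof -
      define r where "r = s - a"
      with that have s: "s = a + r" by simp
      show ?thesis using that
        by (subst escape.simps) (simp add: dec s val C)
    qed
    then show ?thesis by blast
  qed
qed

text \<open>
  On the ray that starts in the code of the composition, the composition and the diagonal function
  cannot have the same domain.
\<close>

lemma diagonal_not_pipeline:
  assumes w: "set w \<subseteq> {..<length gs}" and gs: "\<And>g. g \<in> set gs \<Longrightarrow> right_ideal_morphism g"
  shows "diagonal gs \<noteq> pipeline (map ((!) gs) w)"
proof
  assume eq: "diagonal gs = pipeline (map ((!) gs) w)"
  let ?e = "encode (length gs) w"
  let ?ray = "\<lambda>s. ?e @ replicate s False"
  show False
  proof (cases "\<exists>s. diagonal gs (?ray s) \<noteq> None")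
    case True
    then obtain s x where x: "prefix x (?ray s)" "escape gs (2 * length x) x x"
      by (auto simp: diagonal_def split: if_splits)
    then have "diagonal gs x = Some x" by (auto simp: diagonal_def)
    moreover have "pipeline (map ((!) gs) w) x = None"
      using escape_encode_imp_undefined[OF x(2,1) w] .
    ultimately show False using eq by simp
  next
    case False
    with eq have "\<And>s. pipeline (map ((!) gs) w) (?ray s) = None" by auto
    from eventually_escape[OF w gs this] obtain C where
      C: "\<And>s B u. s \<ge> C \<Longrightarrow> B \<ge> C + s \<Longrightarrow> escape gs B (?e @ u) (?ray s)" by blast
    \<comment> \<open>The point \<open>?ray C\<close> has length at least \<open>C\<close>, so twice its length is at least \<open>C + C\<close>.\<close>
    have "escape gs (2 * length (?ray C)) (?ray C) (?ray C)" by (rule C) auto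
    then have "diagonal gs (?ray C) \<noteq> None" by (auto simp: diagonal_def)
    with False show False by blast
  qed
qed

lemma diagonal_right_ideal_morphism: "right_ideal_morphism (diagonal gs)"
  by (auto simp: right_ideal_morphism_def diagonal_def split: if_splits dest: prefix_prefix)

lemma diagonal_polynomially_balanced: "polynomially_balanced (diagonal gs)"
  unfolding polynomially_balanced_def
  by (intro exI[of _ "[:0, 1:]"]) (auto simp: diagonal_def split: if_splits)

lemma monoid_generate_RM2P_pipeline:
  assumes "f \<in> monoid_generate RM2P (set gs)"
  shows "\<exists>w. set w \<subseteq> {..<length gs} \<and> f = pipeline (map ((!) gs) w)"
  using assms
proof induction
  case one
  then show ?case by (intro exI[of _ "[]"]) (simp add: RM2P_def)
next
  case (incl s)
  then obtain i where "i < length gs" "s = gs ! i" by (auto simp: in_set_conv_nth)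
  then show ?case by (intro exI[of _ "[i]"]) (auto simp: map_comp_def fun_eq_iff split: option.splits)
next
  case (mult a b)
  then obtain u v where "set u \<subseteq> {..<length gs}" "a = pipeline (map ((!) gs) u)"
    "set v \<subseteq> {..<length gs}" "b = pipeline (map ((!) gs) v)" by auto
  then show ?case by (intro exI[of _ "v @ u"]) (simp add: RM2P_def pipeline_append)
qed

section \<open>Composition of Turing machines\<close>

abbreviation halted :: "'q tm \<Rightarrow> 'q \<Rightarrow> bool" where
  "halted M q \<equiv> q = accept M \<or> q = reject M"

lemma step_halted: "halted M q \<Longrightarrow> (step M ^^ t) (q, ts) = (q, ts)"
  by (induction t) auto

text \<open>
  A machine that contains a copy of \<open>M\<close> goes on working when \<open>M\<close> has halted, so the simulation must
  be stopped at the first halting configuration.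
\<close>

lemma first_halting_time:
  assumes "(step M ^^ t) c = (q, ts)" "halted M q"
  obtains t0 where "t0 \<le> t" "(step M ^^ t0) c = (q, ts)"
    "\<And>i. i < t0 \<Longrightarrow> \<not> halted M (fst ((step M ^^ i) c))"
proof -
  let ?P = "\<lambda>i. halted M (fst ((step M ^^ i) c))"
  define t0 where "t0 = (LEAST i. ?P i)"
  have "?P t" using assms by simp
  then have t0: "t0 \<le> t" "?P t0" unfolding t0_def by (rule Least_le, rule LeastI)
  obtain q0 ts0 where c0: "(step M ^^ t0) c = (q0, ts0)" by fastforce
  have "(step M ^^ t) c = (step M ^^ (t - t0)) ((step M ^^ t0) c)"
    using t0(1) by (metis comp_apply funpow_add le_add_diff_inverse2)
  also have "\<dots> = (q0, ts0)" using t0(2) by (simp add: c0 step_halted)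
  finally have "(step M ^^ t0) c = (q, ts)" using assms(1) c0 by simp
  then show ?thesis using that[OF t0(1)] not_less_Least[of _ ?P] t0_def by blast
qed

lemma simulate_until_halting:
  assumes "\<And>p us p' us'. \<not> halted M p \<Longrightarrow> step M (p, us) = (p', us') \<Longrightarrow> step M' (e p, us) = (e p', us')"
    and "\<And>i. i < t \<Longrightarrow> \<not> halted M (fst ((step M ^^ i) (p, us)))"
    and "(step M ^^ t) (p, us) = (p', us')"
  shows "(step M' ^^ t) (e p, us) = (e p', us')"
  using assms(2,3)
proof (induction t arbitrary: p' us')
  case (Suc t)
  obtain q vs where q: "(step M ^^ t) (p, us) = (q, vs)" by fastforce
  with Suc.IH[of q vs] Suc.prems(1) have "(step M' ^^ t) (e p, us) = (e q, vs)" by simp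
  moreover have "step M' (e q, vs) = (e p', us')"
    using Suc.prems(1)[of t] Suc.prems(2) q by (intro assms(1)) auto
  ultimately show ?case by simp
qed simp

type_synonym tapes = "nat \<Rightarrow> tape"

abbreviation symbol_at_head :: "tape \<Rightarrow> symbol" where
  "symbol_at_head T \<equiv> snd T (fst T)"

lemma act_stay [simp]: "act (snd T (fst T), Stay) T = T"
  by (cases T) simp

definition idle :: "(nat \<Rightarrow> symbol) \<Rightarrow> nat \<Rightarrow> symbol \<times> move" where
  "idle r j = (r j, Stay)"

lemma act_idle_list: "map2 act (map (\<lambda>s. (s, Stay)) (map (\<lambda>(h, c). c h) ts)) ts = ts"
  by (induction ts) auto

lemma step_idle:
  assumes "\<not> halted M q" "delta M q (map (\<lambda>(h, c). c h) ts) = (q', map (\<lambda>s. (s, Stay)) (map (\<lambda>(h, c). c h) ts))"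
  shows "step M (q, ts) = (q', ts)"
  using assms act_idle_list by (simp add: comp_def)

lemma wf_tm_delta:
  assumes "wf_tm M" "q \<in> states M" "length ss = ntapes M" "set ss \<subseteq> alphabet M" "delta M q ss = (q', as)"
  shows "q' \<in> states M" "length as = ntapes M" "fst ` set as \<subseteq> alphabet M"
proof -
  from assms(1) have "\<forall>q \<in> states M. \<forall>ss. length ss = ntapes M \<and> set ss \<subseteq> alphabet M \<longrightarrow>
        (case delta M q ss of (q', as) \<Rightarrow>
           q' \<in> states M \<and> length as = ntapes M \<and> fst ` set as \<subseteq> alphabet M)"
    unfolding wf_tm_def by (elim conjE)
  from bspec[OF this assms(2), THEN spec, of ss] assms(3-5)
  show "q' \<in> states M" "length as = ntapes M" "fst ` set as \<subseteq> alphabet M" by simp_all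
qed

text \<open>
  All machines that are combined have the same number of tapes and the same alphabet, so each can
  take over the tapes from another. Tapes are addressed by their index; the values of a tape function at
  indices from \<open>N\<close> on carry no information.
\<close>

locale tape_setting =
  fixes N :: nat and G :: "symbol set"
  assumes N: "N \<ge> 1" and finite_G: "finite G" and Blank_G: "Blank \<in> G" and Letter_G: "Letter b \<in> G"
begin

definition machine :: "nat tm \<Rightarrow> bool" where
  "machine M \<longleftrightarrow> wf_tm M \<and> ntapes M = N \<and> alphabet M = G"

text \<open>
  The number \<open>t\<close> is an upper bound of the running time, since halting configurations do not
  change any more.
\<close>

definition runs :: "nat tm \<Rightarrow> tapes \<Rightarrow> bool \<Rightarrow> tapes \<Rightarrow> nat \<Rightarrow> bool" where
  "runs M \<sigma> b \<sigma>' t \<longleftrightarrow>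
     (step M ^^ t) (start M, map \<sigma> [0..<N]) = (if b then accept M else reject M, map \<sigma>' [0..<N])"

lemma runs_mono:
  assumes "runs M \<sigma> b \<sigma>' t" "t \<le> t'"
  shows "runs M \<sigma> b \<sigma>' t'"
proof -
  have "(step M ^^ t') c = (step M ^^ (t' - t)) ((step M ^^ t) c)" for c
    using assms(2) by (metis comp_apply funpow_add le_add_diff_inverse2)
  then show ?thesis using assms(1) step_halted[of "accept M" M] step_halted[of "reject M" M]
    by (simp add: runs_def)
qed

lemma runs_first:
  assumes "runs M \<sigma> b \<sigma>' t"
  obtains t0 where "t0 \<le> t" "runs M \<sigma> b \<sigma>' t0"
    "\<And>i. i < t0 \<Longrightarrow> \<not> halted M (fst ((step M ^^ i) (start M, map \<sigma> [0..<N])))"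
proof -
  have "halted M (if b then accept M else reject M)" by simp
  from first_halting_time[OF assms[unfolded runs_def] this] show ?thesis
    using that unfolding runs_def by blast
qed

lemma delta_closed:
  assumes "machine M" "q \<in> states M" "length ss = N" "set ss \<subseteq> G" "delta M q ss = (q', as)"
  shows "q' \<in> states M" "length as = N" "fst ` set as \<subseteq> G"
  using wf_tm_delta[OF _ assms(2) _ _ assms(5)] assms(1,3,4) by (auto simp: machine_def)

lemma machine_states:
  assumes "machine M"
  shows "finite (states M)" "start M \<in> states M" "accept M \<in> states M" "reject M \<in> states M"
    "accept M \<noteq> reject M"
  using assms by (auto simp: machine_def wf_tm_def)

text \<open>
  The states of the three machines are distinguished by their residues modulo 3. A machine has only one
  accepting and one rejecting state; these are taken from \<open>M2\<close>, and \<open>M3\<close> passes on to them by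
  one more step.
\<close>

definition branch :: "nat tm \<Rightarrow> nat tm \<Rightarrow> nat tm \<Rightarrow> nat tm" where
  "branch M1 M2 M3 = \<lparr>ntapes = N,
     states = (\<lambda>q. 3 * q) ` states M1 \<union> (\<lambda>q. 3 * q + 1) ` states M2 \<union> (\<lambda>q. 3 * q + 2) ` states M3,
     alphabet = G, start = 3 * start M1, accept = 3 * accept M2 + 1, reject = 3 * reject M2 + 1,
     delta = (\<lambda>q ss. let p = q div 3; rest = map (\<lambda>s. (s, Stay)) ss in
       if q mod 3 = 0 then
         if p = accept M1 then (3 * start M2 + 1, rest)
         else if p = reject M1 then (3 * start M3 + 2, rest)
         else apfst (\<lambda>q. 3 * q) (delta M1 p ss)
       else if q mod 3 = 1 then apfst (\<lambda>q. 3 * q + 1) (delta M2 p ss)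
       else
         if p = accept M3 then (3 * accept M2 + 1, rest)
         else if p = reject M3 then (3 * reject M2 + 1, rest)
         else apfst (\<lambda>q. 3 * q + 2) (delta M3 p ss))\<rparr>"

lemma mod_div_3 [simp]:
  "(3 * q) mod 3 = (0::nat)" "(3 * q + 1) mod 3 = (1::nat)" "(3 * q + 2) mod 3 = (2::nat)"
  "(3 * q) div 3 = (q::nat)" "(3 * q + 1) div 3 = (q::nat)" "(3 * q + 2) div 3 = (q::nat)"
  "Suc (3 * q) mod 3 = (1::nat)" "Suc (Suc (3 * q)) mod 3 = (2::nat)"
  "Suc (3 * q) div 3 = (q::nat)" "Suc (Suc (3 * q)) div 3 = (q::nat)"
  by (simp_all add: mod_Suc div_Suc)

lemma three_ne: "3 * q \<noteq> 3 * p + (1::nat)" "3 * q + 2 \<noteq> 3 * p + (1::nat)"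
  "3 * q \<noteq> Suc (3 * p)" "Suc (Suc (3 * q)) \<noteq> Suc (3 * p)"
  "Suc (3 * q) \<noteq> 3 * p" "Suc (3 * q) \<noteq> Suc (Suc (3 * p))"
  "3 * q \<noteq> Suc (Suc (3 * p))" "Suc (Suc (3 * q)) \<noteq> 3 * p"
  by arith+

lemma machine_branch:
  assumes "machine M1" "machine M2" "machine M3"
  shows "machine (branch M1 M2 M3)"
proof -
  note wf = assms[THEN machine_states(1)] assms[THEN machine_states(2)]
    assms[THEN machine_states(3)] assms[THEN machine_states(4)] assms[THEN machine_states(5)]
  have closed: "q' \<in> states (branch M1 M2 M3) \<and> length as = N \<and> fst ` set as \<subseteq> G"
    if q: "q \<in> states (branch M1 M2 M3)" and ss: "length ss = N" "set ss \<subseteq> G"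
      and d: "delta (branch M1 M2 M3) q ss = (q', as)" for q ss q' as
  proof -
    have rest: "fst ` set (map (\<lambda>s. (s, Stay)) ss) \<subseteq> G" using ss by auto
    from q consider p where "p \<in> states M1" "q = 3 * p" | p where "p \<in> states M2" "q = 3 * p + 1"
      | p where "p \<in> states M3" "q = 3 * p + 2" by (auto simp: branch_def)
    then show ?thesis
    proof cases
      case 1
      obtain p' bs where p': "delta M1 p ss = (p', bs)" by fastforce
      with delta_closed[OF assms(1) 1(1) ss] d 1 wf rest ss(1) show ?thesis
        by (auto simp: branch_def Let_def split: if_splits simp del: set_map del: subsetI)
    next
      case 2
      obtain p' bs where p': "delta M2 p ss = (p', bs)" by fastforce
      with delta_closed[OF assms(2) 2(1) ss] d 2 show ?thesis
        by (auto simp: branch_def Let_def del: subsetI)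
    next
      case 3
      obtain p' bs where p': "delta M3 p ss = (p', bs)" by fastforce
      with delta_closed[OF assms(3) 3(1) ss] d 3 wf rest ss(1) show ?thesis
        by (auto simp: branch_def Let_def split: if_splits simp del: set_map del: subsetI)
    qed
  qed
  have "wf_tm (branch M1 M2 M3)"
    unfolding wf_tm_def
  proof (intro conjI ballI allI impI)
    fix q ss assume "q \<in> states (branch M1 M2 M3)"
      "length ss = ntapes (branch M1 M2 M3) \<and> set ss \<subseteq> alphabet (branch M1 M2 M3)"
    then show "case delta (branch M1 M2 M3) q ss of (q', as) \<Rightarrow>
        q' \<in> states (branch M1 M2 M3) \<and> length as = ntapes (branch M1 M2 M3)
        \<and> fst ` set as \<subseteq> alphabet (branch M1 M2 M3)"
      using closed[of q ss] by (auto simp: branch_def)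
  qed (use wf N finite_G Blank_G Letter_G in \<open>auto simp: branch_def three_ne\<close>)
  then show ?thesis by (simp add: machine_def branch_def)
qed

lemma branch_step1:
  assumes "\<not> halted M1 p" "step M1 (p, us) = (p', us')"
  shows "step (branch M1 M2 M3) (3 * p, us) = (3 * p', us')"
  using assms by (auto simp: branch_def Let_def three_ne split: prod.splits)

lemma branch_step2:
  assumes "\<not> halted M2 p" "step M2 (p, us) = (p', us')"
  shows "step (branch M1 M2 M3) (3 * p + 1, us) = (3 * p' + 1, us')"
  using assms by (auto simp: branch_def Let_def three_ne split: prod.splits)

lemma branch_step3:
  assumes "\<not> halted M3 p" "step M3 (p, us) = (p', us')"
  shows "step (branch M1 M2 M3) (3 * p + 2, us) = (3 * p' + 2, us')"
  using assms by (auto simp: branch_def Let_def three_ne split: prod.splits)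

lemma runs_branch:
  assumes M: "machine M1" "machine M2" "machine M3"
    and 1: "runs M1 \<sigma> b1 \<sigma>1 t1" and 2: "runs (if b1 then M2 else M3) \<sigma>1 b \<sigma>2 t2"
    and t: "t1 + t2 + 2 \<le> t"
  shows "runs (branch M1 M2 M3) \<sigma> b \<sigma>2 t"
proof -
  let ?M = "branch M1 M2 M3"
  obtain s1 where s1: "s1 \<le> t1" "runs M1 \<sigma> b1 \<sigma>1 s1"
    "\<And>i. i < s1 \<Longrightarrow> \<not> halted M1 (fst ((step M1 ^^ i) (start M1, map \<sigma> [0..<N])))"
    using runs_first[OF 1] by metis
  obtain s2 where s2: "s2 \<le> t2" "runs (if b1 then M2 else M3) \<sigma>1 b \<sigma>2 s2"
    "\<And>i. i < s2 \<Longrightarrow> \<not> halted (if b1 then M2 else M3)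
      (fst ((step (if b1 then M2 else M3) ^^ i) (start (if b1 then M2 else M3), map \<sigma>1 [0..<N])))"
    using runs_first[OF 2] by metis
  have part1: "(step ?M ^^ s1) (start ?M, map \<sigma> [0..<N])
      = (3 * (if b1 then accept M1 else reject M1), map \<sigma>1 [0..<N])"
    using simulate_until_halting[where e = "\<lambda>q. 3 * q", OF branch_step1 s1(3) s1(2)[unfolded runs_def]]
    by (simp add: branch_def)
  have wf1: "accept M1 \<noteq> reject M1" using M(1) by (simp add: machine_def wf_tm_def)
  have part2: "step ?M (3 * (if b1 then accept M1 else reject M1), map \<sigma>1 [0..<N])
      = (if b1 then 3 * start M2 + 1 else 3 * start M3 + 2, map \<sigma>1 [0..<N])"
    using wf1 by (intro step_idle) (auto simp: branch_def three_ne Let_def)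
  have upto: "(step ?M ^^ (1 + s1)) (start ?M, map \<sigma> [0..<N])
      = (if b1 then 3 * start M2 + 1 else 3 * start M3 + 2, map \<sigma>1 [0..<N])"
    using part1 part2 by simp
  \<comment> \<open>One step more is needed when it is the third machine that halts.\<close>
  have "\<exists>k\<le>1. (step ?M ^^ (k + s2)) (if b1 then 3 * start M2 + 1 else 3 * start M3 + 2, map \<sigma>1 [0..<N])
    = (if b then accept ?M else reject ?M, map \<sigma>2 [0..<N])"
  proof (cases b1)
    case True
    with simulate_until_halting[where e = "\<lambda>q. 3 * q + 1" and M = M2 and M' = ?M, OF branch_step2 _ , of s2 "start M2" "map \<sigma>1 [0..<N]"]
      s2 have "(step ?M ^^ s2) (3 * start M2 + 1, map \<sigma>1 [0..<N])
        = (3 * (if b then accept M2 else reject M2) + 1, map \<sigma>2 [0..<N])"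
      by (simp add: runs_def)
    then show ?thesis using True by (intro exI[of _ 0]) (simp add: branch_def)
  next
    case False
    with simulate_until_halting[where e = "\<lambda>q. 3 * q + 2" and M = M3 and M' = ?M, OF branch_step3 _ , of s2 "start M3" "map \<sigma>1 [0..<N]"]
      s2 have a: "(step ?M ^^ s2) (3 * start M3 + 2, map \<sigma>1 [0..<N])
        = (3 * (if b then accept M3 else reject M3) + 2, map \<sigma>2 [0..<N])"
      by (simp add: runs_def)
    have wf3: "accept M3 \<noteq> reject M3" using M(3) by (simp add: machine_def wf_tm_def)
    have "step ?M (3 * (if b then accept M3 else reject M3) + 2, map \<sigma>2 [0..<N])
        = (if b then accept ?M else reject ?M, map \<sigma>2 [0..<N])"
      using wf3 by (intro step_idle) (auto simp: branch_def three_ne Let_def)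
    with a False show ?thesis by (intro exI[of _ 1]) simp
  qed
  then obtain k where k: "k \<le> 1" "(step ?M ^^ (k + s2)) (if b1 then 3 * start M2 + 1 else 3 * start M3 + 2, map \<sigma>1 [0..<N])
    = (if b then accept ?M else reject ?M, map \<sigma>2 [0..<N])" by blast
  have "(step ?M ^^ ((k + s2) + (1 + s1))) (start ?M, map \<sigma> [0..<N])
    = (if b then accept ?M else reject ?M, map \<sigma>2 [0..<N])"
    unfolding funpow_add[of "k + s2" "1 + s1"] comp_apply upto k(2) ..
  then have "runs ?M \<sigma> b \<sigma>2 ((k + s2) + (1 + s1))" by (simp only: runs_def)
  then show ?thesis using k(1) s1(1) s2(1) t by (elim runs_mono) linarith
qed

text \<open>
  The body is repeated as long as it accepts. The state 0 is never reached; it is there because a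
  machine must have a rejecting state different from the accepting one.
\<close>

definition loop :: "nat tm \<Rightarrow> nat tm" where
  "loop M = \<lparr>ntapes = N, states = insert 0 (Suc ` states M), alphabet = G, start = Suc (start M),
     accept = Suc (reject M), reject = 0,
     delta = (\<lambda>q ss. if q = 0 then (0, map (\<lambda>s. (s, Stay)) ss)
       else if q - 1 = accept M then (Suc (start M), map (\<lambda>s. (s, Stay)) ss)
                else apfst Suc (delta M (q - 1) ss))\<rparr>"

lemma machine_loop:
  assumes "machine M"
  shows "machine (loop M)"
proof -
  note wf = machine_states[OF assms]
  have "wf_tm (loop M)"
    unfolding wf_tm_def
  proof (intro conjI ballI allI impI)
    fix q ss assume q: "q \<in> states (loop M)"
      "length ss = ntapes (loop M) \<and> set ss \<subseteq> alphabet (loop M)"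
    then show "case delta (loop M) q ss of (q', as) \<Rightarrow>
        q' \<in> states (loop M) \<and> length as = ntapes (loop M) \<and> fst ` set as \<subseteq> alphabet (loop M)"
      using delta_closed[OF assms, of "q - 1" ss] wf
      by (cases "delta M (q - 1) ss") (auto simp: loop_def image_image del: subsetI)
  qed (use wf N finite_G Blank_G Letter_G in \<open>auto simp: loop_def\<close>)
  then show ?thesis by (simp add: machine_def loop_def)
qed

lemma loop_step:
  assumes "\<not> halted M p" "step M (p, us) = (p', us')"
  shows "step (loop M) (Suc p, us) = (Suc p', us')"
  using assms by (auto simp: loop_def split: prod.splits)

lemma runs_loop_body:
  assumes "runs M \<sigma> b \<sigma>' t"
  shows "\<exists>t0\<le>t. (step (loop M) ^^ t0) (start (loop M), map \<sigma> [0..<N])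
      = (Suc (if b then accept M else reject M), map \<sigma>' [0..<N])"
proof -
  obtain t0 where t0: "t0 \<le> t" "runs M \<sigma> b \<sigma>' t0"
    "\<And>i. i < t0 \<Longrightarrow> \<not> halted M (fst ((step M ^^ i) (start M, map \<sigma> [0..<N])))"
    using runs_first[OF assms] by metis
  have "(step (loop M) ^^ t0) (start (loop M), map \<sigma> [0..<N])
      = (Suc (if b then accept M else reject M), map \<sigma>' [0..<N])"
    using simulate_until_halting[where e = Suc, OF loop_step t0(3) t0(2)[unfolded runs_def]]
    by (simp add: loop_def)
  with t0(1) show ?thesis by blast
qed

lemma runs_loop_exit:
  assumes "runs M \<sigma> False \<sigma>' t"
  shows "runs (loop M) \<sigma> True \<sigma>' t"
proof -
  from runs_loop_body[OF assms] obtain t0 where "t0 \<le> t" "runs (loop M) \<sigma> True \<sigma>' t0"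
    by (auto simp: runs_def loop_def)
  then show ?thesis by (rule runs_mono[rotated])
qed

lemma runs_loop_again:
  assumes M: "machine M" and 1: "runs M \<sigma> True \<sigma>1 t1" and 2: "runs (loop M) \<sigma>1 True \<sigma>' t2"
    and t: "t1 + t2 + 1 \<le> t"
  shows "runs (loop M) \<sigma> True \<sigma>' t"
proof -
  from runs_loop_body[OF 1] obtain t0 where t0: "t0 \<le> t1"
    "(step (loop M) ^^ t0) (start (loop M), map \<sigma> [0..<N]) = (Suc (accept M), map \<sigma>1 [0..<N])"
    by auto
  have "step (loop M) (Suc (accept M), map \<sigma>1 [0..<N]) = (start (loop M), map \<sigma>1 [0..<N])"
    using machine_states[OF M] by (intro step_idle) (auto simp: loop_def)
  with t0 have upto: "(step (loop M) ^^ (1 + t0)) (start (loop M), map \<sigma> [0..<N])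
      = (start (loop M), map \<sigma>1 [0..<N])" by simp
  have "(step (loop M) ^^ (t2 + (1 + t0))) (start (loop M), map \<sigma> [0..<N])
      = (accept (loop M), map \<sigma>' [0..<N])"
    unfolding funpow_add[of t2 "1 + t0"] comp_apply upto using 2 by (simp add: runs_def)
  then have "runs (loop M) \<sigma> True \<sigma>' (t2 + (1 + t0))" by (simp add: runs_def)
  then show ?thesis using t0(1) t by (elim runs_mono) linarith
qed

definition visible :: "tapes \<Rightarrow> nat \<Rightarrow> symbol" where
  "visible \<sigma> j = (if j < N then symbol_at_head (\<sigma> j) else Blank)"

text \<open>
  A machine with the single working state 0, accepting state 1 and rejecting state 2. The function
  \<open>D\<close> gives the next state and the actions in terms of the scanned symbols.
\<close>

definition atom :: "((nat \<Rightarrow> symbol) \<Rightarrow> nat \<times> (nat \<Rightarrow> symbol \<times> move)) \<Rightarrow> nat tm" where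
  "atom D = \<lparr>ntapes = N, states = {0, 1, 2}, alphabet = G, start = 0, accept = 1, reject = 2,
     delta = (\<lambda>q ss. case D (\<lambda>j. if j < N then ss ! j else Blank) of
       (q', A) \<Rightarrow> (q', map A [0..<N]))\<rparr>"

definition perform :: "((nat \<Rightarrow> symbol) \<Rightarrow> nat \<Rightarrow> symbol \<times> move) \<Rightarrow> tapes \<Rightarrow> tapes" where
  "perform A \<sigma> j = (if j < N then act (A (visible \<sigma>) j) (\<sigma> j) else \<sigma> j)"

definition sweep :: "((nat \<Rightarrow> symbol) \<Rightarrow> bool) \<Rightarrow> ((nat \<Rightarrow> symbol) \<Rightarrow> nat \<Rightarrow> symbol \<times> move) \<Rightarrow> nat tm" where
  "sweep P A = atom (\<lambda>r. if P r then (0, A r) else (1, idle r))"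

definition once :: "((nat \<Rightarrow> symbol) \<Rightarrow> nat \<Rightarrow> symbol \<times> move) \<Rightarrow> nat tm" where
  "once A = atom (\<lambda>r. (1, A r))"

definition test :: "((nat \<Rightarrow> symbol) \<Rightarrow> bool) \<Rightarrow> nat tm" where
  "test P = atom (\<lambda>r. (if P r then 1 else 2, idle r))"

text \<open>
  This condition keeps a machine inside the alphabet \<open>G\<close>.
\<close>

definition harmless :: "((nat \<Rightarrow> symbol) \<Rightarrow> nat \<Rightarrow> symbol \<times> move) \<Rightarrow> bool" where
  "harmless A \<longleftrightarrow> (\<forall>r. range r \<subseteq> G \<longrightarrow> (\<forall>j<N. fst (A r j) \<in> G))"

lemma harmless_idle: "harmless idle"
  by (auto simp: harmless_def idle_def)

lemma machine_atom:
  assumes "\<And>r. fst (D r) \<le> 2" "harmless (\<lambda>r. snd (D r))"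
  shows "machine (atom D)"
proof -
  have "case delta (atom D) q ss of (q', as) \<Rightarrow> q' \<in> states (atom D) \<and> length as = N \<and> fst ` set as \<subseteq> G"
    if ss: "length ss = N" "set ss \<subseteq> G" for q ss
  proof -
    let ?r = "\<lambda>j. if j < N then ss ! j else Blank"
    obtain q' A where D: "D ?r = (q', A)" by fastforce
    have "range ?r \<subseteq> G" using ss Blank_G by (auto simp: subset_iff)
    then have "\<forall>j<N. fst (snd (D ?r) j) \<in> G" using assms(2) unfolding harmless_def by blast
    then have "\<forall>j<N. fst (A j) \<in> G" by (simp add: D)
    moreover have "q' \<le> 2" using assms(1)[of ?r] by (simp add: D)
    ultimately show ?thesis by (auto simp: atom_def D)
  qed
  then show ?thesis
    using N finite_G Blank_G Letter_G
    by (auto simp: machine_def wf_tm_def atom_def)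
qed

lemma machine_sweep: "harmless A \<Longrightarrow> machine (sweep P A)"
  unfolding sweep_def using harmless_idle by (intro machine_atom) (auto simp: harmless_def)

lemma machine_once: "harmless A \<Longrightarrow> machine (once A)"
  unfolding once_def by (intro machine_atom) auto

lemma machine_test: "machine (test P)"
  unfolding test_def using harmless_idle by (intro machine_atom) auto

lemma perform_idle: "perform idle \<sigma> = \<sigma>"
  by (auto simp: perform_def idle_def visible_def)

lemma step_atom:
  assumes "q \<noteq> 1" "q \<noteq> 2" "D (visible \<sigma>) = (q', A (visible \<sigma>))"
  shows "step (atom D) (q, map \<sigma> [0..<N]) = (q', map (perform A \<sigma>) [0..<N])"
proof -
  have "(\<lambda>j. if j < N then map (\<lambda>(h, c). c h) (map \<sigma> [0..<N]) ! j else Blank) = visible \<sigma>"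
    by (auto simp: visible_def split: prod.splits)
  moreover have "map2 act (map (A (visible \<sigma>)) [0..<N]) (map \<sigma> [0..<N]) = map (perform A \<sigma>) [0..<N]"
    by (intro nth_equalityI) (auto simp: perform_def)
  ultimately show ?thesis using assms by (simp add: atom_def del: map_map)
qed

lemma runs_once: "1 \<le> t \<Longrightarrow> runs (once A) \<sigma> True (perform A \<sigma>) t"
proof (rule runs_mono[of _ _ _ _ 1])
  have "step (once A) (0, map \<sigma> [0..<N]) = (1, map (perform A \<sigma>) [0..<N])"
    unfolding once_def by (rule step_atom) auto
  then show "runs (once A) \<sigma> True (perform A \<sigma>) 1"
    by (simp add: runs_def once_def atom_def del: step.simps)
qed

lemma runs_test: "1 \<le> t \<Longrightarrow> runs (test P) \<sigma> (P (visible \<sigma>)) \<sigma> t"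
proof (rule runs_mono[of _ _ _ _ 1])
  have "step (test P) (0, map \<sigma> [0..<N]) = (if P (visible \<sigma>) then 1 else 2, map \<sigma> [0..<N])"
    using step_atom[of 0 "\<lambda>r. (if P r then 1 else 2, idle r)" \<sigma> _ idle]
    by (simp add: test_def perform_idle del: step.simps)
  then show "runs (test P) \<sigma> (P (visible \<sigma>)) \<sigma> 1"
    by (simp add: runs_def test_def atom_def del: step.simps)
qed

text \<open>
  The run of a sweep is described by naming the tapes \<open>\<tau> i\<close> after \<open>i\<close> rounds.
\<close>

lemma runs_sweep:
  assumes "\<And>i. i < n \<Longrightarrow> P (visible (\<tau> i)) \<and> perform A (\<tau> i) = \<tau> (Suc i)"
    and "\<not> P (visible (\<tau> n))" and "n + 1 \<le> t"
  shows "runs (sweep P A) (\<tau> 0) True (\<tau> n) t"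
proof -
  let ?M = "sweep P A"
  have "(step ?M ^^ i) (0, map (\<tau> 0) [0..<N]) = (0, map (\<tau> i) [0..<N])" if "i \<le> n" for i
    using that
  proof (induction i)
    case (Suc i)
    then have "P (visible (\<tau> i))" "perform A (\<tau> i) = \<tau> (Suc i)" using assms(1)[of i] by auto
    then have "step ?M (0, map (\<tau> i) [0..<N]) = (0, map (\<tau> (Suc i)) [0..<N])"
      unfolding sweep_def by (subst step_atom[where q' = 0 and A = A]) auto
    with Suc show ?case by simp
  qed simp
  moreover have "step ?M (0, map (\<tau> n) [0..<N]) = (1, map (\<tau> n) [0..<N])"
    unfolding sweep_def using assms(2)
    by (subst step_atom[where q' = 1 and A = idle]) (auto simp: perform_idle)
  ultimately have "(step ?M ^^ (n + 1)) (0, map (\<tau> 0) [0..<N]) = (1, map (\<tau> n) [0..<N])" by simp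
  then have "runs ?M (\<tau> 0) True (\<tau> n) (n + 1)" by (simp add: runs_def sweep_def atom_def)
  then show ?thesis using assms(3) by (rule runs_mono)
qed

end

section \<open>Words on tapes\<close>

definition tp :: "int \<Rightarrow> word \<Rightarrow> tape" where
  "tp k y = (k, word_contents y)"

lemma fst_tp [simp]: "fst (tp k y) = k" and snd_tp [simp]: "snd (tp k y) = word_contents y"
  by (simp_all add: tp_def)

lemma word_contents_nat [simp]:
  "word_contents y (int k) = (if k < length y then Letter (y ! k) else Blank)"
  by (simp add: word_contents_def)

lemma word_contents_Nil: "word_contents [] = (\<lambda>_. Blank)"
  by (auto simp: word_contents_def)

lemma word_contents_neg: "i < 0 \<Longrightarrow> word_contents y i = Blank"
  by (simp add: word_contents_def)

lemma word_contents_snoc: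
  "(word_contents y)(int (length y) := Letter b) = word_contents (y @ [b])"
  by (auto simp: word_contents_def fun_eq_iff nth_append nat_less_iff)

lemma word_contents_take:
  "i < length y \<Longrightarrow> (word_contents (take (Suc i) y))(int i := Blank) = word_contents (take i y)"
  by (auto simp: word_contents_def fun_eq_iff nat_less_iff)

lemma act_snoc: "act (Letter b, MoveRight) (tp (int (length y)) y) = tp (int (length (y @ [b]))) (y @ [b])"
  by (simp add: tp_def word_contents_snoc)

lemma act_move [simp]: "act (snd T (fst T), m) T = (fst T + offset m, snd T)"
  by (cases T) simp

lemma act_move_tp [simp]: "act (word_contents y k, m) (tp k y) = tp (k + offset m) y"
  by (simp add: tp_def)

lemma act_letter_tp [simp]:
  "k < length y \<Longrightarrow> act (Letter (y ! k), m) (tp (int k) y) = tp (int k + offset m) y"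
  using act_move_tp[of y "int k" m] by (simp del: act_move_tp)

context tape_setting begin

definition seq :: "nat tm \<Rightarrow> nat tm \<Rightarrow> nat tm"  (infixr ";;" 55) where
  "M1 ;; M2 = branch M1 M2 (test (\<lambda>_. False))"

lemma machine_seq: "machine M1 \<Longrightarrow> machine M2 \<Longrightarrow> machine (M1 ;; M2)"
  by (simp add: seq_def machine_branch machine_test)

lemma runs_seq:
  assumes "machine M1" "machine M2" "runs M1 \<sigma> True \<sigma>1 t1" "runs M2 \<sigma>1 b \<sigma>2 t2" "t1 + t2 + 2 \<le> t"
  shows "runs (M1 ;; M2) \<sigma> b \<sigma>2 t"
  unfolding seq_def using assms by (intro runs_branch[OF _ _ _ assms(3)]) (auto simp: machine_test)

lemma harmless_upd:
  assumes "harmless A" "\<And>r. range r \<subseteq> G \<Longrightarrow> f r \<in> G"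
  shows "harmless (\<lambda>r. (A r)(j := (f r, m r)))"
  using assms by (auto simp: harmless_def)

lemma harmless_upd_same: "harmless A \<Longrightarrow> harmless (\<lambda>r. (A r)(j := (r i, m r)))"
  by (rule harmless_upd) auto

lemma harmless_upd_Blank: "harmless A \<Longrightarrow> harmless (\<lambda>r. (A r)(j := (Blank, m r)))"
  by (rule harmless_upd) (auto intro: Blank_G)

lemma harmless_upd_Letter: "harmless A \<Longrightarrow> harmless (\<lambda>r. (A r)(j := (Letter b, m r)))"
  by (rule harmless_upd) (auto intro: Letter_G)

lemmas harmless_rules = harmless_idle harmless_upd_same harmless_upd_Blank harmless_upd_Letter
lemmas machine_rules = machine_seq machine_sweep machine_once machine_test harmless_rules

lemma perform_upd:
  "j < N \<Longrightarrow> perform (\<lambda>r. (A r)(j := (f r, m r))) \<sigma>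
     = (perform A \<sigma>)(j := act (f (visible \<sigma>), m (visible \<sigma>)) (\<sigma> j))"
  by (auto simp: perform_def)

lemmas tape_simps = perform_def visible_def idle_def fun_eq_iff

definition shift_head :: "nat \<Rightarrow> move \<Rightarrow> nat tm" where
  "shift_head j m = once (\<lambda>r. (idle r)(j := (r j, m)))"

lemma machine_shift_head: "machine (shift_head j m)"
  unfolding shift_head_def by (intro machine_rules)

lemma runs_shift_head:
  assumes "j < N" "1 \<le> t"
  shows "runs (shift_head j m) \<sigma> True (\<sigma>(j := (fst (\<sigma> j) + offset m, snd (\<sigma> j)))) t"
  using runs_once[OF assms(2), of "\<lambda>r. (idle r)(j := (r j, m))" \<sigma>] assms(1)
  by (simp add: shift_head_def perform_upd perform_idle visible_def)

definition to_end :: "nat \<Rightarrow> nat tm" where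
  "to_end j = sweep (\<lambda>r. r j \<noteq> Blank) (\<lambda>r. (idle r)(j := (r j, MoveRight)))"

lemma machine_to_end: "machine (to_end j)"
  unfolding to_end_def by (intro machine_rules)

lemma runs_to_end:
  assumes "\<sigma> j = tp (int k) y" "k \<le> length y" "j < N" "length y + 1 \<le> t"
  shows "runs (to_end j) \<sigma> True (\<sigma>(j := tp (int (length y)) y)) t"
proof -
  let ?\<tau> = "\<lambda>i. \<sigma>(j := tp (int (k + i)) y)"
  have "runs (to_end j) (?\<tau> 0) True (?\<tau> (length y - k)) t"
    unfolding to_end_def
    using assms by (intro runs_sweep) (auto simp: tape_simps add.commute simp flip: of_nat_add)
  moreover have "?\<tau> 0 = \<sigma>" using assms(1) by auto
  ultimately show ?thesis using assms(2) by simp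
qed

definition rewind :: "nat \<Rightarrow> nat tm" where
  "rewind j = shift_head j MoveLeft ;;
     sweep (\<lambda>r. r j \<noteq> Blank) (\<lambda>r. (idle r)(j := (r j, MoveLeft))) ;; shift_head j MoveRight"

lemma machine_rewind: "machine (rewind j)"
  unfolding rewind_def by (intro machine_rules machine_shift_head)

lemma runs_rewind:
  assumes "\<sigma> j = tp (int k) y" "k \<le> length y" "j < N" "length y + 10 \<le> t"
  shows "runs (rewind j) \<sigma> True (\<sigma>(j := tp 0 y)) t"
proof -
  let ?\<tau> = "\<lambda>i. \<sigma>(j := tp (int k - 1 - int i) y)"
  let ?S = "sweep (\<lambda>r. r j \<noteq> Blank) (\<lambda>r. (idle r)(j := (r j, MoveLeft)))"
  have 1: "runs (shift_head j MoveLeft) \<sigma> True (?\<tau> 0) 1"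
    using runs_shift_head[OF assms(3), of 1 MoveLeft \<sigma>] assms(1) by (simp add: tp_def)
  have "word_contents y (int k - 1 - int i) \<noteq> Blank" if "i < k" for i
  proof -
    have "int k - 1 - int i = int (k - 1 - i)" using that by simp
    then show ?thesis using that assms(2) by (simp del: of_nat_diff)
  qed
  then have 2: "runs ?S (?\<tau> 0) True (?\<tau> k) (k + 1)"
    using assms by (intro runs_sweep) (auto simp: tape_simps word_contents_neg algebra_simps)
  have 3: "runs (shift_head j MoveRight) (?\<tau> k) True (\<sigma>(j := tp 0 y)) 1"
    using runs_shift_head[OF assms(3), of 1 MoveRight "?\<tau> k"] by (simp add: tp_def)
  show ?thesis unfolding rewind_def
    by (rule runs_seq[OF _ _ 1 runs_seq[OF _ _ 2 3 order_refl]])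
      (use assms in \<open>auto intro!: machine_rules machine_shift_head\<close>)
qed

definition erase :: "nat \<Rightarrow> nat tm" where
  "erase j = shift_head j MoveLeft ;;
     sweep (\<lambda>r. r j \<noteq> Blank) (\<lambda>r. (idle r)(j := (Blank, MoveLeft))) ;; shift_head j MoveRight"

lemma machine_erase: "machine (erase j)"
  unfolding erase_def by (intro machine_rules machine_shift_head)

text \<open>
  Erasing from right to left leaves a prefix of the word at each moment, so the intermediate tapes
  are again of the form \<open>tp\<close>.
\<close>

lemma act_erase_last:
  assumes "i < n" "n \<le> length y"
  shows "act (Blank, MoveLeft) (tp (int n - 1 - int i) (take (n - i) y))
    = tp (int n - 1 - int (Suc i)) (take (n - Suc i) y)"
proof -
  have "n - i = Suc (n - Suc i)" "int n - 1 - int i = int (n - Suc i)" using assms by auto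
  then show ?thesis using assms word_contents_take[of "n - Suc i" y] by (simp add: tp_def del: of_nat_diff)
qed

lemma word_contents_last_ne_Blank:
  assumes "i < n" "n \<le> length y"
  shows "word_contents (take (n - i) y) (int n - 1 - int i) \<noteq> Blank"
proof -
  have "int n - 1 - int i = int (n - Suc i)" using assms by auto
  then show ?thesis using assms by (simp del: of_nat_diff)
qed

lemma runs_erase:
  assumes "\<sigma> j = tp (int (length y)) y" "j < N" "length y + 10 \<le> t"
  shows "runs (erase j) \<sigma> True (\<sigma>(j := tp 0 [])) t"
proof -
  let ?n = "length y"
  let ?\<tau> = "\<lambda>i. \<sigma>(j := tp (int ?n - 1 - int i) (take (?n - i) y))"
  let ?S = "sweep (\<lambda>r. r j \<noteq> Blank) (\<lambda>r. (idle r)(j := (Blank, MoveLeft)))"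
  have 1: "runs (shift_head j MoveLeft) \<sigma> True (?\<tau> 0) 1"
    using runs_shift_head[OF assms(2), of 1 MoveLeft \<sigma>] assms(1) by (simp add: tp_def)
  have 2: "runs ?S (?\<tau> 0) True (?\<tau> ?n) (?n + 1)"
    using assms word_contents_last_ne_Blank[of _ ?n y] act_erase_last[of _ ?n y]
    by (intro runs_sweep) (auto simp: tape_simps word_contents_neg simp del: act.simps)
  have 3: "runs (shift_head j MoveRight) (?\<tau> ?n) True (\<sigma>(j := tp 0 [])) 1"
    using runs_shift_head[OF assms(2), of 1 MoveRight "?\<tau> ?n"] by (simp add: tp_def)
  show ?thesis unfolding erase_def
    by (rule runs_seq[OF _ _ 1 runs_seq[OF _ _ 2 3 order_refl]])
      (use assms in \<open>auto intro!: machine_rules machine_shift_head\<close>)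
qed

end

text \<open>
  The invariant under which the well-formedness of \<open>M\<close> says anything about its next step.
\<close>

definition proper :: "'q tm \<Rightarrow> 'q config \<Rightarrow> bool" where
  "proper M c \<longleftrightarrow> fst c \<in> states M \<and> length (snd c) = ntapes M \<and>
     (\<forall>j<ntapes M. \<forall>i. snd (snd c ! j) i \<in> alphabet M)"

lemma proper_step:
  assumes "wf_tm M" "proper M c" "\<not> halted M (fst c)"
  obtains q' as where "delta M (fst c) (map symbol_at_head (snd c)) = (q', as)"
    "step M c = (q', map2 act as (snd c))" "length as = ntapes M" "q' \<in> states M"
    "\<forall>j<ntapes M. fst (as ! j) \<in> alphabet M"
proof -
  obtain q ts where c: "c = (q, ts)" by fastforce
  have sym: "(\<lambda>(h, c). c h) = symbol_at_head" by (auto simp: fun_eq_iff)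
  obtain q' as where d: "delta M q (map symbol_at_head ts) = (q', as)" by fastforce
  have "set (map symbol_at_head ts) \<subseteq> alphabet M"
  proof
    fix s assume "s \<in> set (map symbol_at_head ts)"
    then obtain T where "s = symbol_at_head T" "T \<in> set ts" unfolding set_map by (rule imageE)
    moreover from this(2) obtain j where "j < length ts" "T = ts ! j" unfolding in_set_conv_nth by blast
    ultimately have "j < length ts" "s = symbol_at_head (ts ! j)" by simp_all
    then show "s \<in> alphabet M" using assms(2) by (simp add: proper_def c)
  qed
  from wf_tm_delta[OF assms(1) _ _ this d] assms(2)
  have "q' \<in> states M" "length as = ntapes M" "fst ` set as \<subseteq> alphabet M" by (auto simp: proper_def c)
  then show ?thesis using assms(3) d by (intro that[of q' as]) (auto simp: c sym subset_iff)
qed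

lemma proper_step_proper:
  assumes "wf_tm M" "proper M c"
  shows "proper M (step M c)"
proof (cases "halted M (fst c)")
  case True
  then show ?thesis using assms(2) by (cases c) auto
next
  case False
  obtain q' as where "delta M (fst c) (map symbol_at_head (snd c)) = (q', as)"
    and *: "step M c = (q', map2 act as (snd c))" "length as = ntapes M" "q' \<in> states M"
      "\<forall>j<ntapes M. fst (as ! j) \<in> alphabet M"
    by (rule proper_step[OF assms False])
  have "snd (act (as ! j) (snd c ! j)) i \<in> alphabet M" if "j < ntapes M" for i j
    using *(4) that assms(2) that by (cases "as ! j"; cases "snd c ! j") (auto simp: proper_def)
  with *(1-3) assms(2) show ?thesis by (auto simp: proper_def)
qed

lemma proper_init:
  assumes "wf_tm M"
  shows "proper M (init_config M x)"
proof -
  have "Letter b \<in> alphabet M" "Blank \<in> alphabet M" "start M \<in> states M" "1 \<le> ntapes M" for b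
    using assms by (auto simp: wf_tm_def)
  then show ?thesis by (auto simp: proper_def init_config_def word_contents_def nth_Cons')
qed

lemma proper_steps: "wf_tm M \<Longrightarrow> proper M c \<Longrightarrow> proper M ((step M ^^ t) c)"
  by (induction t) (auto intro: proper_step_proper)

text \<open>
  Steps move a head by at most one cell. Distances are measured from the current head position because
  this is the position from which a clean-up has to start.
\<close>

lemma locality:
  assumes "wf_tm M" "proper M c" "j < ntapes M"
  shows "\<bar>fst (snd ((step M ^^ t) c) ! j) - fst (snd c ! j)\<bar> \<le> int t \<and>
    (\<forall>i. snd (snd ((step M ^^ t) c) ! j) i \<noteq> snd (snd c ! j) i \<longrightarrow>
       \<bar>i - fst (snd ((step M ^^ t) c) ! j)\<bar> \<le> int t)"
proof (induction t)
  case (Suc t)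
  let ?c = "(step M ^^ t) c"
  show ?case
  proof (cases "halted M (fst ?c)")
    case True
    then have "step M ?c = ?c" by (cases ?c) auto
    then have eq: "(step M ^^ Suc t) c = ?c" by simp
    show ?thesis unfolding eq
    proof (intro conjI allI impI)
      show "\<bar>fst (snd ?c ! j) - fst (snd c ! j)\<bar> \<le> int (Suc t)" using Suc by linarith
      fix i assume "snd (snd ?c ! j) i \<noteq> snd (snd c ! j) i"
      with Suc have "\<bar>i - fst (snd ?c ! j)\<bar> \<le> int t" by blast
      then show "\<bar>i - fst (snd ?c ! j)\<bar> \<le> int (Suc t)" by linarith
    qed
  next
    case False
    have pr: "proper M ?c" using assms by (simp add: proper_steps)
    obtain q' as where "delta M (fst ?c) (map symbol_at_head (snd ?c)) = (q', as)"
      and *: "step M ?c = (q', map2 act as (snd ?c))" "length as = ntapes M" "q' \<in> states M"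
        "\<forall>j<ntapes M. fst (as ! j) \<in> alphabet M"
      by (rule proper_step[OF assms(1) pr False])
    obtain s m where sm: "as ! j = (s, m)" by fastforce
    obtain h f where hf: "snd ?c ! j = (h, f)" by fastforce
    have "length (snd ?c) = ntapes M" using pr by (simp add: proper_def)
    with * assms(3) have "snd (step M ?c) ! j = (h + offset m, f(h := s))" by (simp add: sm hf)
    moreover have "\<bar>offset m\<bar> \<le> 1" by (cases m) auto
    moreover from Suc hf have ih: "\<bar>h - fst (snd c ! j)\<bar> \<le> int t"
      "\<And>i. f i \<noteq> snd (snd c ! j) i \<Longrightarrow> \<bar>i - h\<bar> \<le> int t" by auto
    moreover have "\<bar>i - (h + offset m)\<bar> \<le> int (Suc t)" if "(f(h := s)) i \<noteq> snd (snd c ! j) i" for i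
      using that ih(2)[of i] \<open>\<bar>offset m\<bar> \<le> 1\<close> by (cases "i = h") auto
    ultimately show ?thesis by auto
  qed
qed simp

section \<open>Calling a given machine as a subroutine\<close>

text \<open>
  The heads of the work tapes are not at cell 0 when a subroutine is called. The subroutine does not
  notice this, as the action of a machine commutes with shifts.
\<close>

definition shift :: "int \<Rightarrow> tape \<Rightarrow> tape" where
  "shift h T = (fst T + h, \<lambda>i. snd T (i - h))"

lemma shift_symbol [simp]: "snd (shift h T) (fst (shift h T)) = snd T (fst T)"
  by (simp add: shift_def)

lemma act_shift: "act a (shift h T) = shift h (act a T)"
  by (cases a; cases T) (auto simp: shift_def fun_eq_iff)

fun is_letter :: "symbol \<Rightarrow> bool" where
  "is_letter (Letter b) = True"
| "is_letter _ = False"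

fun letters :: "symbol \<Rightarrow> word" where
  "letters (Letter b) = [b]"
| "letters _ = []"

definition letters_from :: "(int \<Rightarrow> symbol) \<Rightarrow> int \<Rightarrow> nat \<Rightarrow> word" where
  "letters_from c a n = concat (map (\<lambda>i. letters (c (a + int i))) [0..<n])"

lemma letters_from_0 [simp]: "letters_from c a 0 = []"
  by (simp add: letters_from_def)

lemma letters_from_Suc: "letters_from c a (Suc n) = letters_from c a n @ letters (c (a + int n))"
  by (simp add: letters_from_def)

text \<open>
  Any window that covers the nonblank cells of a tape gives the word on it, so the position of the
  word within the window need not be known.
\<close>

lemma letters_from_word:
  assumes c: "\<And>i. c i = word_contents y (i - h)"
    and cover: "\<And>i. c i \<noteq> Blank \<Longrightarrow> a \<le> i \<and> i < a + int n"
  shows "letters_from c a n = y"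
proof (cases "y = []")
  case True
  then show ?thesis by (induction n) (simp_all add: letters_from_Suc c word_contents_Nil)
next
  case False
  then have "c h \<noteq> Blank" "c (h + int (length y) - 1) \<noteq> Blank"
    by (auto simp: c word_contents_def nat_less_iff)
  then have a: "a \<le> h" "h + int (length y) - 1 < a + int n" using cover by blast+
  have "letters_from c a k = take (nat (a + int k - h)) y" for k
  proof (induction k)
    case (Suc k)
    consider "a + int k < h" | m where "a + int k - h = int m" by (metis diff_ge_0_iff_ge linorder_not_le nonneg_int_cases)
    then show ?case
    proof cases
      case 1
      then have "c (a + int k) = Blank" by (simp add: c word_contents_neg)
      then show ?thesis using 1 by (simp add: letters_from_Suc Suc)
    next
      case 2
      then have "a + int (Suc k) - h = int (Suc m)" by simp
      moreover have "c (a + int k) = word_contents y (int m)" using c[of "a + int k"] 2 by simp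
      ultimately show ?thesis unfolding letters_from_Suc Suc 2
        by (simp add: take_Suc_conv_app_nth del: of_nat_Suc)
    qed
  qed (use a in simp)
  with a show ?thesis by simp
qed

text \<open>
  The tapes have the following roles.
  
    \<^item> Tape 0 holds the input \<open>z\<close>. Its head separates the prefixes that have been examined from the rest.
    \<^item> Tape 1 holds the current prefix \<open>x\<close> of \<open>z\<close>, which is read as a program.
    \<^item> Tape 2 holds \<open>2 * length x\<close> marks, the bound on the lengths of values.
    \<^item> Tape 3 holds the current value.
    \<^item> Tape 4 counts the steps of a subroutine. It is blank between calls; a mark under its head
      after a failed call reports that a generator was undefined.
    \<^item> Tapes 5 to \<open>4 + K\<close> form the bank on which subroutines work.
    \<^item> Tape \<open>5 + K\<close>, the last one, receives the output. While prefixes are examined, it holds the part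
      of \<open>z\<close> that has been read on tape 0.
\<close>

locale simulator = tape_setting +
  fixes K :: nat
  assumes N_eq: "N = 6 + K"
begin

lemma index_less [simp]: "0 < N" "Suc 0 < N" "2 < N" "3 < N" "4 < N" "5 < N"
  by (simp_all add: N_eq)

text \<open>
  The machine \<open>M\<close> on the tapes of the bank, with one mark on tape 4 for each step. The case of a
  symbol outside the alphabet of \<open>M\<close> only serves to make the machine well-formed.
\<close>

definition embed :: "nat tm \<Rightarrow> nat tm" where
  "embed M = \<lparr>ntapes = N, states = states M, alphabet = G,
     start = start M, accept = accept M, reject = reject M,
     delta = (\<lambda>q ss. let bs = take (ntapes M) (drop 5 ss) in
       if set bs \<subseteq> alphabet M then
         case delta M q bs of (q', as) \<Rightarrow>
           (q', map (\<lambda>j. if j = 4 then (Letter True, MoveRight)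
                         else if 5 \<le> j \<and> j < 5 + ntapes M then as ! (j - 5)
                         else (ss ! j, Stay)) [0..<N])
       else (reject M, map (\<lambda>s. (s, Stay)) ss))\<rparr>"

definition admissible :: "nat tm \<Rightarrow> bool" where
  "admissible M \<longleftrightarrow> wf_tm M \<and> ntapes M \<le> K \<and> alphabet M \<subseteq> G"

lemma machine_embed:
  assumes "admissible M"
  shows "machine (embed M)"
proof -
  have wf: "wf_tm M" and n: "5 + ntapes M \<le> N" and al: "alphabet M \<subseteq> G"
    using assms N_eq by (auto simp: admissible_def)
  have "case delta (embed M) q ss of (q', as) \<Rightarrow> q' \<in> states M \<and> length as = N \<and> fst ` set as \<subseteq> G"
    if q: "q \<in> states M" and ss: "length ss = N" "set ss \<subseteq> G" for q ss
  proof (cases "set (take (ntapes M) (drop 5 ss)) \<subseteq> alphabet M")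
    case True
    obtain q' as where d: "delta M q (take (ntapes M) (drop 5 ss)) = (q', as)" by fastforce
    have len: "length (take (ntapes M) (drop 5 ss)) = ntapes M" using n ss by simp
    note cl = wf_tm_delta[OF wf q len True d]
    have "fst (as ! (j - 5)) \<in> G" if "5 \<le> j" "j < 5 + ntapes M" for j
    proof -
      have "as ! (j - 5) \<in> set as" using that cl(2) by simp
      then show ?thesis using cl(3) al by blast
    qed
    moreover have "ss ! j \<in> G" if "j < N" for j using ss that nth_mem[of j ss] by auto
    ultimately show ?thesis using True cl(1) Letter_G by (auto simp: embed_def d Let_def)
  next
    case False
    moreover have "reject M \<in> states M" using wf by (simp add: wf_tm_def)
    ultimately show ?thesis using ss by (simp add: embed_def Let_def image_image)
  qed
  then have "\<forall>q\<in>states (embed M). \<forall>ss. length ss = ntapes (embed M) \<and> set ss \<subseteq> alphabet (embed M) \<longrightarrow>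
      (case delta (embed M) q ss of (q', as) \<Rightarrow> q' \<in> states (embed M) \<and>
        length as = ntapes (embed M) \<and> fst ` set as \<subseteq> alphabet (embed M))"
    by (simp add: embed_def)
  moreover have "finite (states M)" "start M \<in> states M" "accept M \<in> states M" "reject M \<in> states M"
    "accept M \<noteq> reject M" using wf by (auto simp: wf_tm_def)
  ultimately show ?thesis unfolding machine_def wf_tm_def using N finite_G Blank_G Letter_G
    by (auto simp: embed_def)
qed

text \<open>
  The tapes after \<open>i\<close> steps of an embedded machine: \<open>ts\<close> are the tapes of the machine itself,
  \<open>h\<close> gives the positions of its cells 0 in the bank, and \<open>m\<close> is the number of marks at the
  beginning.
\<close>

definition placed :: "(nat \<Rightarrow> int) \<Rightarrow> nat \<Rightarrow> tapes \<Rightarrow> nat \<Rightarrow> tape list \<Rightarrow> tapes" where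
  "placed h m \<sigma> i ts j =
     (if j = 4 then tp (int (m + i)) (replicate (m + i) True)
      else if 5 \<le> j \<and> j < 5 + length ts then shift (h (j - 5)) (ts ! (j - 5))
      else \<sigma> j)"

lemma step_embed:
  assumes "admissible M" "proper M (q, ts)" "\<not> halted M q" "step M (q, ts) = (q', ts')"
  shows "step (embed M) (q, map (placed h m \<sigma> i ts) [0..<N])
     = (q', map (placed h m \<sigma> (Suc i) ts') [0..<N])"
proof -
  have wf: "wf_tm M" and n: "5 + ntapes M \<le> N" using assms(1) N_eq by (auto simp: admissible_def)
  have len: "length ts = ntapes M" using assms(2) by (simp add: proper_def)
  have nh: "\<not> halted M (fst (q, ts))" using assms(3) by simp
  obtain q1 as where d: "delta M (fst (q, ts)) (map symbol_at_head (snd (q, ts))) = (q1, as)"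
    and *: "step M (q, ts) = (q1, map2 act as (snd (q, ts)))" "length as = ntapes M" "q1 \<in> states M"
      "\<forall>j<ntapes M. fst (as ! j) \<in> alphabet M"
    by (rule proper_step[OF wf assms(2) nh])
  then have q1: "q1 = q'" and ts': "ts' = map2 act as ts" using assms(4) by simp_all
  let ?ss = "map (\<lambda>(h, c). c h) (map (placed h m \<sigma> i ts) [0..<N])"
  have ss: "?ss ! j = symbol_at_head (placed h m \<sigma> i ts j)" if "j < N" for j
    using that by (simp add: case_prod_beta)
  have bs: "take (ntapes M) (drop 5 ?ss) = map symbol_at_head ts"
    using n len by (intro nth_equalityI) (auto simp: placed_def case_prod_beta)
  have "set (map symbol_at_head ts) \<subseteq> alphabet M"
  proof
    fix s assume "s \<in> set (map symbol_at_head ts)"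
    then obtain T where "s = symbol_at_head T" "T \<in> set ts" unfolding set_map by (rule imageE)
    moreover from this(2) obtain j where "j < length ts" "T = ts ! j" unfolding in_set_conv_nth by blast
    ultimately have "j < length ts" "s = symbol_at_head (ts ! j)" by simp_all
    then show "s \<in> alphabet M" using assms(2) by (simp add: proper_def)
  qed
  then have "step (embed M) (q, map (placed h m \<sigma> i ts) [0..<N]) =
     (q', map2 act (map (\<lambda>j. if j = 4 then (Letter True, MoveRight)
                         else if 5 \<le> j \<and> j < 5 + ntapes M then as ! (j - 5)
                         else (?ss ! j, Stay)) [0..<N]) (map (placed h m \<sigma> i ts) [0..<N]))"
    using d assms(3) unfolding step.simps by (simp only: embed_def tm.simps bs Let_def if_True fst_conv snd_conv prod.case q1 if_False)
  also have "map2 act (map (\<lambda>j. if j = 4 then (Letter True, MoveRight)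
                         else if 5 \<le> j \<and> j < 5 + ntapes M then as ! (j - 5)
                         else (?ss ! j, Stay)) [0..<N]) (map (placed h m \<sigma> i ts) [0..<N])
     = map (placed h m \<sigma> (Suc i) ts') [0..<N]"
  proof (intro nth_equalityI)
    fix j assume "j < length (map2 act (map (\<lambda>j. if j = 4 then (Letter True, MoveRight)
                         else if 5 \<le> j \<and> j < 5 + ntapes M then as ! (j - 5)
                         else (?ss ! j, Stay)) [0..<N]) (map (placed h m \<sigma> i ts) [0..<N]))"
    then have j: "j < N" by simp
    have "act (Letter True, MoveRight) (tp (int (m + i)) (replicate (m + i) True))
      = tp (int (m + Suc i)) (replicate (m + Suc i) True)"
      using act_snoc[of True "replicate (m + i) True"] by (simp add: replicate_append_same)
    then show "map2 act (map (\<lambda>j. if j = 4 then (Letter True, MoveRight)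
                         else if 5 \<le> j \<and> j < 5 + ntapes M then as ! (j - 5)
                         else (?ss ! j, Stay)) [0..<N]) (map (placed h m \<sigma> i ts) [0..<N]) ! j
      = map (placed h m \<sigma> (Suc i) ts') [0..<N] ! j"
      using j ss[OF j] len *(2) by (auto simp: placed_def ts' act_shift simp del: act.simps upt_Suc)
  qed simp
  finally show ?thesis .
qed

lemma runs_embed:
  assumes M: "admissible M" and halt: "(step M ^^ t) (init_config M d) = (q, ts)" "halted M q"
    and \<sigma>4: "\<sigma> 4 = tp (int m) (replicate m True)"
    and bank: "\<And>j. j < ntapes M \<Longrightarrow> \<sigma> (5 + j) = shift (h j) (snd (init_config M d) ! j)"
  obtains t0 where "t0 \<le> t" "(step M ^^ t0) (init_config M d) = (q, ts)"
    "runs (embed M) \<sigma> (q = accept M) (placed h m \<sigma> t0 ts) t0"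
proof -
  let ?c = "init_config M d"
  have wf: "wf_tm M" using M by (simp add: admissible_def)
  obtain t0 where t0: "t0 \<le> t" "(step M ^^ t0) ?c = (q, ts)"
    "\<And>i. i < t0 \<Longrightarrow> \<not> halted M (fst ((step M ^^ i) ?c))"
    using first_halting_time[OF halt] by metis
  have len: "length (snd ?c) = ntapes M" using proper_init[OF wf, of d] by (simp add: proper_def)
  have init: "placed h m \<sigma> 0 (snd ?c) = \<sigma>"
  proof
    fix j
    show "placed h m \<sigma> 0 (snd ?c) j = \<sigma> j"
      using \<sigma>4 bank[of "j - 5"] len by (auto simp: placed_def)
  qed
  have "(step (embed M) ^^ i) (start M, map \<sigma> [0..<N])
      = (fst ((step M ^^ i) ?c), map (placed h m \<sigma> i (snd ((step M ^^ i) ?c))) [0..<N])"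
    if "i \<le> t0" for i
    using that
  proof (induction i)
    case 0
    then show ?case by (simp add: init del: upt_Suc) (simp add: init_config_def)
  next
    case (Suc i)
    obtain q1 ts1 where c1: "(step M ^^ i) ?c = (q1, ts1)" by fastforce
    obtain q2 ts2 where c2: "step M (q1, ts1) = (q2, ts2)" by fastforce
    have "proper M (q1, ts1)" using proper_steps[OF wf proper_init[OF wf], of i d] c1 by simp
    moreover have "\<not> halted M q1" using t0(3)[of i] c1 Suc.prems by simp
    ultimately have "step (embed M) (q1, map (placed h m \<sigma> i ts1) [0..<N])
     = (q2, map (placed h m \<sigma> (Suc i) ts2) [0..<N])" using c2 by (intro step_embed[OF M])
    with Suc c1 c2 show ?case by (simp del: step.simps upt_Suc)
  qed
  from this[of t0] t0(2) halt(2) have "runs (embed M) \<sigma> (q = accept M) (placed h m \<sigma> t0 ts) t0"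
    by (auto simp: runs_def embed_def simp del: upt_Suc)
  with t0 that show ?thesis by blast
qed

lemma runs_once_eq: "perform A \<sigma> = \<sigma>' \<Longrightarrow> runs (once A) \<sigma> True \<sigma>' 1"
  using runs_once[of 1 A \<sigma>] by simp

text \<open>
  Moves the value from tape 3 to the first tape of the bank. Tape 4 receives one mark for each letter
  and one more. With the marks for the steps added, the number of marks exceeds both the number of
  steps and the distance of any letter of the argument from the final head position.
\<close>

definition load :: "nat tm" where
  "load =
     once (\<lambda>r. (idle r)(4 := (Letter True, MoveRight))) ;;
     sweep (\<lambda>r. r 3 \<noteq> Blank)
       (\<lambda>r. (idle r)(3 := (r 3, MoveRight), 4 := (Letter True, MoveRight), 5 := (r 3, MoveRight))) ;;
     once (\<lambda>r. (idle r)(3 := (r 3, MoveLeft), 5 := (r 5, MoveLeft))) ;;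
     sweep (\<lambda>r. r 3 \<noteq> Blank) (\<lambda>r. (idle r)(3 := (Blank, MoveLeft), 5 := (r 5, MoveLeft))) ;;
     once (\<lambda>r. (idle r)(3 := (r 3, MoveRight), 5 := (r 5, MoveRight)))"

lemma machine_load: "machine load"
  unfolding load_def by (intro machine_rules)

lemma act_shift_tp_move [simp]:
  "act (word_contents y k, mv) (shift h (tp k y)) = shift h (tp (k + offset mv) y)"
  by (simp add: act_shift)

lemma runs_load:
  assumes \<sigma>: "\<sigma> 3 = tp 0 d" "\<sigma> 4 = tp 0 []" "snd (\<sigma> 5) = (\<lambda>_. Blank)" and t: "2 * length d + 20 \<le> t"
  shows "runs load \<sigma> True (\<sigma>(3 := tp 0 [], 4 := tp (int (length d + 1)) (replicate (length d + 1) True),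
           5 := shift (fst (\<sigma> 5)) (tp 0 d))) t"
proof -
  let ?n = "length d" and ?h = "fst (\<sigma> 5)"
  let ?m = "\<lambda>i. tp (int (1 + i)) (replicate (1 + i) True)"
  have \<sigma>5: "\<sigma> 5 = shift ?h (tp 0 [])"
    using \<sigma>(3) by (cases "\<sigma> 5") (simp add: shift_def word_contents_Nil)
  let ?\<tau> = "\<lambda>i. \<sigma>(3 := tp (int i) d, 4 := ?m i, 5 := shift ?h (tp (int i) (take i d)))"
  let ?\<rho> = "\<lambda>i. \<sigma>(3 := tp (int ?n - 1 - int i) (take (?n - i) d), 4 := ?m ?n,
              5 := shift ?h (tp (int ?n - 1 - int i) d))"
  let ?A = "once (\<lambda>r. (idle r)(4 := (Letter True, MoveRight)))"
  let ?B = "sweep (\<lambda>r. r 3 \<noteq> Blank)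
       (\<lambda>r. (idle r)(3 := (r 3, MoveRight), 4 := (Letter True, MoveRight), 5 := (r 3, MoveRight)))"
  let ?C = "once (\<lambda>r. (idle r)(3 := (r 3, MoveLeft), 5 := (r 5, MoveLeft)))"
  let ?D = "sweep (\<lambda>r. r 3 \<noteq> Blank) (\<lambda>r. (idle r)(3 := (Blank, MoveLeft), 5 := (r 5, MoveLeft)))"
  let ?E = "once (\<lambda>r. (idle r)(3 := (r 3, MoveRight), 5 := (r 5, MoveRight)))"
  have "perform (\<lambda>r. (idle r)(4 := (Letter True, MoveRight))) \<sigma> = ?\<tau> 0"
    using \<sigma>(1,2) \<sigma>5 act_snoc[of True "[]"] by (auto simp: tape_simps simp del: act.simps)
  then have A: "runs ?A \<sigma> True (?\<tau> 0) 1"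
    by (rule runs_once_eq)
  have mark: "act (Letter True, MoveRight) (?m i) = ?m (Suc i)" for i
    using act_snoc[of True "replicate (1 + i) True"] by (simp add: replicate_append_same del: act.simps)
  have copy: "act (Letter (d ! i), MoveRight) (shift ?h (tp (int i) (take i d)))
      = shift ?h (tp (int (Suc i)) (take (Suc i) d))" if "i < ?n" for i
    using act_snoc[of "d ! i" "take i d"] that by (simp add: act_shift take_Suc_conv_app_nth del: act.simps)
  have B: "runs ?B (?\<tau> 0) True (?\<tau> ?n) (?n + 1)"
    using mark copy by (intro runs_sweep) (auto simp: tape_simps add.commute simp del: act.simps)
  have "perform (\<lambda>r. (idle r)(3 := (r 3, MoveLeft), 5 := (r 5, MoveLeft))) (?\<tau> ?n) = ?\<rho> 0"
    by (auto simp: tape_simps shift_def tp_def)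
  then have C: "runs ?C (?\<tau> ?n) True (?\<rho> 0) 1"
    by (rule runs_once_eq)
  have D: "runs ?D (?\<rho> 0) True (?\<rho> ?n) (?n + 1)"
    using word_contents_last_ne_Blank[of _ ?n d] act_erase_last[of _ ?n d]
    by (intro runs_sweep) (auto simp: tape_simps word_contents_neg algebra_simps simp del: act.simps)
  have "perform (\<lambda>r. (idle r)(3 := (r 3, MoveRight), 5 := (r 5, MoveRight))) (?\<rho> ?n)
      = \<sigma>(3 := tp 0 [], 4 := ?m ?n, 5 := shift ?h (tp 0 d))"
    by (auto simp: tape_simps shift_def tp_def)
  then have E: "runs ?E (?\<rho> ?n) True (\<sigma>(3 := tp 0 [], 4 := ?m ?n, 5 := shift ?h (tp 0 d))) 1"
    by (rule runs_once_eq)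
  have "runs load \<sigma> True (\<sigma>(3 := tp 0 [], 4 := ?m ?n, 5 := shift ?h (tp 0 d))) t"
    unfolding load_def
    by (rule runs_seq[OF _ _ A runs_seq[OF _ _ B runs_seq[OF _ _ C runs_seq[OF _ _ D E order_refl] order_refl] order_refl]])
      (use t in \<open>auto intro!: machine_rules\<close>)
  then show ?thesis by (simp add: add.commute)
qed

definition on_bank :: "nat \<Rightarrow> bool" where
  "on_bank j \<longleftrightarrow> 5 \<le> j \<and> j < 5 + K"

lemma on_bank_less: "on_bank j \<Longrightarrow> j < N"
  by (simp add: on_bank_def N_eq)

lemma not_on_bank [simp]: "\<not> on_bank 0" "\<not> on_bank (Suc 0)" "\<not> on_bank 2" "\<not> on_bank 3" "\<not> on_bank 4"
  "\<not> on_bank (5 + K)"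
  by (simp_all add: on_bank_def)

definition bank_left :: "(nat \<Rightarrow> symbol) \<Rightarrow> nat \<Rightarrow> symbol \<times> move" where
  "bank_left r j = (if on_bank j then (r j, MoveLeft) else idle r j)"

text \<open>
  Letters seen on tape \<open>k\<close> are appended to tape 3, and the bank is erased from left to right.
\<close>

definition gather :: "nat \<Rightarrow> (nat \<Rightarrow> symbol) \<Rightarrow> nat \<Rightarrow> symbol \<times> move" where
  "gather k r j =
     (if on_bank j then (Blank, MoveRight)
      else if j = 3 \<and> is_letter (r k) then (r k, MoveRight)
      else idle r j)"

lemma harmless_bank_left: "harmless bank_left"
  by (auto simp: harmless_def bank_left_def idle_def)

lemma harmless_gather: "harmless (gather k)"
  using Blank_G by (auto simp: harmless_def gather_def idle_def)

text \<open>
  If tape 4 carries \<open>w\<close> marks, then its head passes over them three times, and the heads of the bank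
  go \<open>w\<close> cells to the left and then \<open>2 * w\<close> cells to the right. The last pass erases the marks.
\<close>

definition collect :: "nat \<Rightarrow> nat tm" where
  "collect k =
     shift_head 4 MoveLeft ;;
     sweep (\<lambda>r. r 4 \<noteq> Blank) (\<lambda>r. (bank_left r)(4 := (r 4, MoveLeft))) ;;
     shift_head 4 MoveRight ;;
     sweep (\<lambda>r. r 4 \<noteq> Blank) (\<lambda>r. (gather k r)(4 := (r 4, MoveRight))) ;;
     shift_head 4 MoveLeft ;;
     sweep (\<lambda>r. r 4 \<noteq> Blank) (\<lambda>r. (gather k r)(4 := (Blank, MoveLeft))) ;;
     shift_head 4 MoveRight"

lemma machine_collect: "machine (collect k)"
  unfolding collect_def by (intro machine_rules machine_shift_head harmless_bank_left harmless_gather)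

text \<open>
  The tapes after \<open>i\<close> rounds of the first pass of \<open>collect\<close>, with \<open>T\<close> as tape 4.
\<close>

definition bank_moved :: "tapes \<Rightarrow> nat \<Rightarrow> tape \<Rightarrow> tapes" where
  "bank_moved \<sigma> i T j =
     (if on_bank j then (fst (\<sigma> j) - int i, snd (\<sigma> j)) else if j = 4 then T else \<sigma> j)"

text \<open>
  The tapes when the heads of the bank have moved right by \<open>i\<close> cells from the end of the first pass. Both
  later passes are covered; they differ only in what happens to tape 4, which is \<open>T\<close>.
\<close>

definition gathered :: "tapes \<Rightarrow> nat \<Rightarrow> nat \<Rightarrow> nat \<Rightarrow> tape \<Rightarrow> tapes" where
  "gathered \<sigma> k w i T j =
     (if on_bank j then (fst (\<sigma> j) - int w + int i,
        \<lambda>p. if fst (\<sigma> j) - int w \<le> p \<and> p < fst (\<sigma> j) - int w + int i then Blank else snd (\<sigma> j) p)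
      else if j = 3 then
        (let y = letters_from (snd (\<sigma> k)) (fst (\<sigma> k) - int w) i in tp (int (length y)) y)
      else if j = 4 then T else \<sigma> j)"

lemma perform_bank_left:
  "perform (\<lambda>r. (bank_left r)(4 := (r 4, MoveLeft))) (bank_moved \<sigma> i T)
     = bank_moved \<sigma> (Suc i) (fst T - 1, snd T)"
  by (rule ext) (auto simp: perform_def visible_def bank_left_def idle_def bank_moved_def on_bank_less)

lemma perform_gather:
  assumes k: "on_bank k"
  shows "perform (\<lambda>r. (gather k r)(4 := (f (r 4), m))) (gathered \<sigma> k w i T)
     = gathered \<sigma> k w (Suc i) (act (f (snd T (fst T)), m) T)"
proof
  fix j
  let ?A = "\<lambda>r. (gather k r)(4 := (f (r 4), m))"
  let ?\<tau> = "gathered \<sigma> k w i T"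
  let ?c = "snd (\<sigma> k)" and ?a = "fst (\<sigma> k) - int w"
  have vis: "visible ?\<tau> k = ?c (?a + int i)"
    using k by (simp add: visible_def gathered_def on_bank_less)
  show "perform ?A ?\<tau> j = gathered \<sigma> k w (Suc i) (act (f (snd T (fst T)), m) T) j"
  proof (cases "j = 3")
    case True
    have "perform ?A ?\<tau> 3 = act (gather k (visible ?\<tau>) 3) (?\<tau> 3)"
      by (simp add: perform_def)
    also have "\<dots> = gathered \<sigma> k w (Suc i) (act (f (snd T (fst T)), m) T) 3"
    proof (cases "is_letter (?c (?a + int i))")
      case True
      then obtain b where b: "?c (?a + int i) = Letter b" by (cases "?c (?a + int i)") auto
      then show ?thesis using act_snoc[of b "letters_from ?c ?a i"]
        by (simp add: gather_def vis gathered_def letters_from_Suc Let_def del: act.simps)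
    next
      case False
      then have "letters (?c (?a + int i)) = []" by (cases "?c (?a + int i)") auto
      moreover from False have "gather k (visible ?\<tau>) 3 = idle (visible ?\<tau>) 3"
        by (simp add: gather_def vis)
      moreover have "act (idle (visible ?\<tau>) 3) (?\<tau> 3) = ?\<tau> 3"
        by (simp add: idle_def visible_def)
      ultimately show ?thesis by (simp add: gathered_def letters_from_Suc)
    qed
    finally show ?thesis by (simp add: True)
  next
    case False
    then show ?thesis
      by (auto simp: perform_def visible_def gather_def idle_def gathered_def on_bank_less fun_eq_iff simp del: act.simps)
        (auto)
  qed
qed

lemma runs_collect:
  assumes \<sigma>: "\<sigma> 3 = tp 0 []" "\<sigma> 4 = tp (int w) (replicate w True)"
    and near: "\<And>j i. on_bank j \<Longrightarrow> snd (\<sigma> j) i \<noteq> Blank \<Longrightarrow> fst (\<sigma> j) - int w \<le> i \<and> i < fst (\<sigma> j) + int w"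
    and k: "on_bank k" and y: "snd (\<sigma> k) = (\<lambda>i. word_contents y (i - h))"
    and t: "3 * w + 40 \<le> t"
  obtains \<sigma>' where "runs (collect k) \<sigma> True \<sigma>' t"
    "\<sigma>' 3 = tp (int (length y)) y" "\<sigma>' 4 = tp 0 []" "\<And>j. on_bank j \<Longrightarrow> snd (\<sigma>' j) = (\<lambda>_. Blank)"
    "\<And>j. \<not> on_bank j \<Longrightarrow> j \<noteq> 3 \<Longrightarrow> j \<noteq> 4 \<Longrightarrow> \<sigma>' j = \<sigma> j"
proof -
  let ?m = "replicate w True"
  let ?S1 = "sweep (\<lambda>r. r 4 \<noteq> Blank) (\<lambda>r. (bank_left r)(4 := (r 4, MoveLeft)))"
  let ?S2 = "sweep (\<lambda>r. r 4 \<noteq> Blank) (\<lambda>r. (gather k r)(4 := (r 4, MoveRight)))"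
  let ?S3 = "sweep (\<lambda>r. r 4 \<noteq> Blank) (\<lambda>r. (gather k r)(4 := (Blank, MoveLeft)))"
  \<comment> \<open>The three passes: to the left, then twice to the right; the last one erases tape 4.\<close>
  let ?\<alpha> = "\<lambda>i. bank_moved \<sigma> i (tp (int w - 1 - int i) ?m)"
  let ?\<beta> = "\<lambda>i. gathered \<sigma> k w i (tp (int i) ?m)"
  let ?\<gamma> = "\<lambda>i. gathered \<sigma> k w (w + i) (tp (int w - 1 - int i) (take (w - i) ?m))"
  let ?\<sigma>' = "gathered \<sigma> k w (w + w) (tp 0 [])"
  have "\<sigma>(4 := (fst (\<sigma> 4) + offset MoveLeft, snd (\<sigma> 4))) = ?\<alpha> 0"
    using \<sigma>(2) by (auto simp: bank_moved_def fun_eq_iff tp_def)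
  then have 1: "runs (shift_head 4 MoveLeft) \<sigma> True (?\<alpha> 0) 1"
    using runs_shift_head[of 4 1 MoveLeft \<sigma>] by simp
  have ne: "word_contents ?m (int w - 1 - int i) \<noteq> Blank" if "i < w" for i
    using that by (simp add: word_contents_def)
  have 2: "runs ?S1 (?\<alpha> 0) True (?\<alpha> w) (w + 1)"
  proof (rule runs_sweep)
    fix i assume "i < w"
    then show "visible (?\<alpha> i) 4 \<noteq> Blank
      \<and> perform (\<lambda>r. (bank_left r)(4 := (r 4, MoveLeft))) (?\<alpha> i) = ?\<alpha> (Suc i)"
      using ne[of i] unfolding perform_bank_left by (simp add: visible_def bank_moved_def tp_def algebra_simps)
  qed (simp_all add: visible_def bank_moved_def word_contents_neg)
  have "(?\<alpha> w)(4 := (fst (?\<alpha> w 4) + offset MoveRight, snd (?\<alpha> w 4))) = ?\<beta> 0"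
    using \<sigma>(1) by (auto simp: bank_moved_def gathered_def fun_eq_iff tp_def)
  then have 3: "runs (shift_head 4 MoveRight) (?\<alpha> w) True (?\<beta> 0) 1"
    using runs_shift_head[of 4 1 MoveRight "?\<alpha> w"] by simp
  have 4: "runs ?S2 (?\<beta> 0) True (?\<beta> w) (w + 1)"
  proof (rule runs_sweep)
    fix i assume i: "i < w"
    have "act (word_contents ?m (int i), MoveRight) (tp (int i) ?m) = tp (int (Suc i)) ?m"
      unfolding act_move_tp by (simp add: add.commute)
    then show "visible (?\<beta> i) 4 \<noteq> Blank
      \<and> perform (\<lambda>r. (gather k r)(4 := (r 4, MoveRight))) (?\<beta> i) = ?\<beta> (Suc i)"
      unfolding perform_gather[OF k, of "\<lambda>s. s"] fst_tp snd_tp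
      using i by (simp add: visible_def gathered_def)
  qed (simp_all add: visible_def gathered_def)
  have "(?\<beta> w)(4 := (fst (?\<beta> w 4) + offset MoveLeft, snd (?\<beta> w 4))) = ?\<gamma> 0"
    by (auto simp: gathered_def fun_eq_iff tp_def)
  then have 5: "runs (shift_head 4 MoveLeft) (?\<beta> w) True (?\<gamma> 0) 1"
    using runs_shift_head[of 4 1 MoveLeft "?\<beta> w"] by simp
  have 6: "runs ?S3 (?\<gamma> 0) True (?\<gamma> w) (w + 1)"
  proof (rule runs_sweep)
    fix i assume i: "i < w"
    then have "act (Blank, MoveLeft) (tp (int w - 1 - int i) (take (w - i) ?m))
      = tp (int w - 1 - int (Suc i)) (take (w - Suc i) ?m)"
      by (intro act_erase_last) auto
    moreover have "word_contents (take (w - i) ?m) (int w - 1 - int i) \<noteq> Blank"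
      using i by (intro word_contents_last_ne_Blank) auto
    ultimately show "visible (?\<gamma> i) 4 \<noteq> Blank
      \<and> perform (\<lambda>r. (gather k r)(4 := (Blank, MoveLeft))) (?\<gamma> i) = ?\<gamma> (Suc i)"
      unfolding perform_gather[OF k, of "\<lambda>s. Blank"]
      by (simp add: visible_def gathered_def del: act.simps take_replicate)
  qed (simp_all add: visible_def gathered_def word_contents_neg)
  have "(?\<gamma> w)(4 := (fst (?\<gamma> w 4) + offset MoveRight, snd (?\<gamma> w 4))) = ?\<sigma>'"
    by (auto simp: gathered_def fun_eq_iff tp_def)
  then have 7: "runs (shift_head 4 MoveRight) (?\<gamma> w) True ?\<sigma>' 1"
    using runs_shift_head[of 4 1 MoveRight "?\<gamma> w"] by simp
  have "runs (collect k) \<sigma> True ?\<sigma>' t" unfolding collect_def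
    by (rule runs_seq[OF _ _ 1 runs_seq[OF _ _ 2 runs_seq[OF _ _ 3 runs_seq[OF _ _ 4
          runs_seq[OF _ _ 5 runs_seq[OF _ _ 6 7 order_refl] order_refl] order_refl] order_refl] order_refl]])
      (use t in \<open>auto intro!: machine_rules machine_shift_head harmless_bank_left harmless_gather\<close>)
  moreover have "letters_from (snd (\<sigma> k)) (fst (\<sigma> k) - int w) (w + w) = y"
  proof (rule letters_from_word[where h = h])
    fix i assume "snd (\<sigma> k) i \<noteq> Blank"
    from near[OF k this] show "fst (\<sigma> k) - int w \<le> i \<and> i < fst (\<sigma> k) - int w + int (w + w)" by auto
  qed (simp add: y)
  moreover have "snd (?\<sigma>' j) = (\<lambda>_. Blank)" if "on_bank j" for j
  proof
    fix p
    have "fst (\<sigma> j) - int w \<le> p \<and> p < fst (\<sigma> j) - int w + int (w + w)" if "snd (\<sigma> j) p \<noteq> Blank"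
      using near[OF \<open>on_bank j\<close> that] by auto
    then show "snd (?\<sigma>' j) p = Blank" using that by (auto simp: gathered_def)
  qed
  ultimately show ?thesis by (intro that[of ?\<sigma>']) (auto simp: gathered_def Let_def)
qed

text \<open>
  One call of a generator on the value on tape 3. When the generator is undefined, the head of tape 4 is
  left on a mark. The output of \<open>M\<close> is on its last tape, which has index \<open>4 + ntapes M\<close>.
\<close>

definition exec :: "nat tm \<Rightarrow> nat tm" where
  "exec M = branch (load ;; embed M) (collect (4 + ntapes M)) (shift_head 4 MoveLeft ;; test (\<lambda>_. False))"

lemma machine_exec: "admissible M \<Longrightarrow> machine (exec M)"
  unfolding exec_def
  by (intro machine_branch machine_seq machine_load machine_embed machine_collect machine_test machine_shift_head)

definition clean :: "tapes \<Rightarrow> bool" where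
  "clean \<sigma> \<longleftrightarrow> \<sigma> 4 = tp 0 [] \<and> (\<forall>j. on_bank j \<longrightarrow> snd (\<sigma> j) = (\<lambda>_. Blank))"

text \<open>
  By locality, the cells that differ from the initial ones lie within the number of steps from the
  final head positions. The cells of the argument do so within this number plus the length of the argument.
  So the marks on tape 4 are enough for \<open>collect\<close>.
\<close>

lemma runs_exec:
  assumes M: "admissible M" and comp: "computes_in_time M T g"
    and \<sigma>: "\<sigma> 3 = tp 0 d" "clean \<sigma>" and t: "10 * (T (length d) + length d) + 100 \<le> t"
  obtains \<sigma>' where "runs (exec M) \<sigma> (g d \<noteq> None) \<sigma>' t"
    "g d = None \<Longrightarrow> symbol_at_head (\<sigma>' 4) \<noteq> Blank"
    "\<And>y. g d = Some y \<Longrightarrow> \<sigma>' 3 = tp (int (length y)) y \<and> clean \<sigma>'"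
    "\<And>j. \<not> on_bank j \<Longrightarrow> j \<noteq> 3 \<Longrightarrow> j \<noteq> 4 \<Longrightarrow> \<sigma>' j = \<sigma> j"
proof -
  have wf: "wf_tm M" and nK: "ntapes M \<le> K" using M by (auto simp: admissible_def)
  have n1: "1 \<le> ntapes M" using wf by (simp add: wf_tm_def)
  let ?c = "init_config M d"
  let ?out = "4 + ntapes M"
  obtain t1 where t1: "t1 \<le> T (length d)" "case (step M ^^ t1) ?c of (q, ts) \<Rightarrow>
      (case g d of None \<Rightarrow> q = reject M | Some y \<Rightarrow> q = accept M \<and> snd (last ts) = word_contents y)"
    using comp[unfolded computes_in_time_def, THEN spec, of d] by (elim exE conjE)
  obtain q ts where "(step M ^^ t1) ?c = (q, ts)" by fastforce
  with t1 have run: "t1 \<le> T (length d)" "(step M ^^ t1) ?c = (q, ts)"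
    "case g d of None \<Rightarrow> q = reject M | Some y \<Rightarrow> q = accept M \<and> snd (last ts) = word_contents y"
    by simp_all
  then have halt: "halted M q" by (auto split: option.splits)
  have acc: "accept M \<noteq> reject M" using wf by (simp add: wf_tm_def)
  with run(3) have q: "q = accept M \<longleftrightarrow> g d \<noteq> None" by (auto split: option.splits)
  have bank0: "on_bank 5" using n1 nK by (simp add: on_bank_def)
  let ?m = "length d + 1"
  let ?\<sigma>1 = "\<sigma>(3 := tp 0 [], 4 := tp (int ?m) (replicate ?m True), 5 := shift (fst (\<sigma> 5)) (tp 0 d))"
  have L: "runs load \<sigma> True ?\<sigma>1 (2 * length d + 20)"
    using \<sigma> bank0 by (intro runs_load) (auto simp: clean_def)
  let ?h = "\<lambda>j. fst (\<sigma> (5 + j))"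
  have init: "?\<sigma>1 (5 + j) = shift (?h j) (snd ?c ! j)" if "j < ntapes M" for j
  proof (cases "j = 0")
    case True
    then show ?thesis by (simp add: init_config_def tp_def)
  next
    case False
    have "on_bank (5 + j)" using that nK by (simp add: on_bank_def)
    with \<sigma>(2) have "snd (\<sigma> (5 + j)) = (\<lambda>_. Blank)" by (simp add: clean_def)
    then show ?thesis using False that
      by (cases "\<sigma> (5 + j)") (simp add: init_config_def shift_def nth_Cons' word_contents_Nil)
  qed
  obtain t0 where t0: "t0 \<le> t1" "(step M ^^ t0) ?c = (q, ts)"
    "runs (embed M) ?\<sigma>1 (q = accept M) (placed ?h ?m ?\<sigma>1 t0 ts) t0"
    by (rule runs_embed[OF M run(2) halt, of ?\<sigma>1 ?m ?h]) (use init in auto)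
  obtain \<sigma>2 where \<sigma>2_def: "\<sigma>2 = placed ?h ?m ?\<sigma>1 t0 ts" by simp
  let ?w = "?m + t0"
  have len: "length ts = ntapes M" using proper_steps[OF wf proper_init[OF wf], of t0 d] t0(2) by (simp add: proper_def)
  have \<sigma>2: "\<sigma>2 3 = tp 0 []" "\<sigma>2 4 = tp (int ?w) (replicate ?w True)"
    "\<And>j. \<not> on_bank j \<Longrightarrow> j \<noteq> 3 \<Longrightarrow> j \<noteq> 4 \<Longrightarrow> \<sigma>2 j = \<sigma> j"
    using nK bank0 by (auto simp: \<sigma>2_def placed_def on_bank_def len)
  have B: "runs (load ;; embed M) \<sigma> (g d \<noteq> None) \<sigma>2 (2 * length d + 22 + t0)"
    using runs_seq[OF machine_load machine_embed[OF M] L t0(3)] q by (simp add: \<sigma>2_def)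
  show ?thesis
  proof (cases "g d")
    case None
    let ?\<sigma>3 = "\<sigma>2(4 := (fst (\<sigma>2 4) + offset MoveLeft, snd (\<sigma>2 4)))"
    have "runs (shift_head 4 MoveLeft) \<sigma>2 True ?\<sigma>3 1" by (rule runs_shift_head) auto
    from runs_seq[OF machine_shift_head machine_test this runs_test[OF order_refl] order_refl]
    have C: "runs (shift_head 4 MoveLeft ;; test (\<lambda>_. False)) \<sigma>2 False ?\<sigma>3 (1 + 1 + 2)" .
    have "runs (exec M) \<sigma> False ?\<sigma>3 t" unfolding exec_def
      by (rule runs_branch[OF _ _ _ B[unfolded None], of _ _ _ _ "1 + 1 + 2"])
        (use C None t run(1) t0(1) in \<open>auto intro!: machine_seq machine_load machine_embed[OF M] machine_collect machine_test machine_shift_head\<close>)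
    moreover have "symbol_at_head (?\<sigma>3 4) \<noteq> Blank"
      unfolding \<sigma>2(2) by (simp add: word_contents_def)
    ultimately show ?thesis using None \<sigma>2(3) by (intro that[of ?\<sigma>3]) auto
  next
    case (Some y)
    have out: "on_bank ?out" using n1 nK by (simp add: on_bank_def)
    have "last ts = ts ! (ntapes M - 1)" using len n1 by (subst last_conv_nth) auto
    moreover have "\<sigma>2 ?out = shift (?h (ntapes M - 1)) (ts ! (ntapes M - 1))"
      using n1 len by (auto simp: \<sigma>2_def placed_def)
    ultimately have y: "snd (\<sigma>2 ?out) = (\<lambda>i. word_contents y (i - ?h (ntapes M - 1)))"
      using run(3) Some by (simp add: shift_def)
    have near: "fst (\<sigma>2 j) - int ?w \<le> i \<and> i < fst (\<sigma>2 j) + int ?w"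
      if j: "on_bank j" and nb: "snd (\<sigma>2 j) i \<noteq> Blank" for j i
    proof (cases "j < 5 + ntapes M")
      case False
      with j have "\<sigma>2 j = \<sigma> j" using n1 by (auto simp: \<sigma>2_def placed_def on_bank_def len)
      with nb j \<sigma>(2) show ?thesis by (simp add: clean_def)
    next
      case True
      define k where "k = j - 5"
      have k: "k < ntapes M" "j = 5 + k" using True j n1 by (auto simp: k_def on_bank_def)
      have \<sigma>2j: "\<sigma>2 j = shift (?h k) (ts ! k)" using k len by (simp add: \<sigma>2_def placed_def)
      have loc: "\<bar>fst (ts ! k) - fst (snd ?c ! k)\<bar> \<le> int t0"
        "\<And>p. snd (ts ! k) p \<noteq> snd (snd ?c ! k) p \<Longrightarrow> \<bar>p - fst (ts ! k)\<bar> \<le> int t0"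
        using locality[OF wf proper_init[OF wf, of d] k(1), of t0] by (simp_all add: t0(2))
      have start0: "fst (snd ?c ! k) = 0"
        using k(1) by (auto simp: init_config_def nth_Cons')
      have supp: "0 \<le> p \<and> p < int (length d)" if "snd (snd ?c ! k) p \<noteq> Blank" for p
        using that k(1) by (auto simp: init_config_def nth_Cons' word_contents_def split: if_splits)
      let ?p = "i - ?h k"
      have "snd (ts ! k) ?p \<noteq> Blank" using nb unfolding \<sigma>2j by (simp add: shift_def)
      then have "\<bar>?p - fst (ts ! k)\<bar> \<le> int t0 \<or> (0 \<le> ?p \<and> ?p < int (length d))"
        using loc(2)[of ?p] supp[of ?p] by metis
      then have "fst (ts ! k) - int ?w \<le> ?p \<and> ?p < fst (ts ! k) + int ?w"
        using loc(1) start0 by auto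
      then show ?thesis unfolding \<sigma>2j by (simp add: shift_def)
    qed
    obtain \<sigma>3 where C: "runs (collect ?out) \<sigma>2 True \<sigma>3 (3 * ?w + 40)"
      and \<sigma>3: "\<sigma>3 3 = tp (int (length y)) y" "\<sigma>3 4 = tp 0 []" "\<And>j. on_bank j \<Longrightarrow> snd (\<sigma>3 j) = (\<lambda>_. Blank)"
      "\<And>j. \<not> on_bank j \<Longrightarrow> j \<noteq> 3 \<Longrightarrow> j \<noteq> 4 \<Longrightarrow> \<sigma>3 j = \<sigma>2 j"
      using runs_collect[OF \<sigma>2(1,2) near out y order_refl] by blast
    have "runs (exec M) \<sigma> True \<sigma>3 t" unfolding exec_def
      by (rule runs_branch[OF _ _ _ B[unfolded Some], of _ _ _ _ "3 * ?w + 40"])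
        (use C Some t run(1) t0(1) in \<open>auto intro!: machine_seq machine_load machine_embed[OF M] machine_collect machine_test machine_shift_head\<close>)
    then show ?thesis using Some \<sigma>3 \<sigma>2(3) by (intro that[of \<sigma>3]) (auto simp: clean_def)
  qed
qed

end

section \<open>A machine for the diagonal function\<close>

lemma computes_in_time_mono:
  assumes "computes_in_time M T f" "\<And>n. T n \<le> T' n"
  shows "computes_in_time M T' f"
  unfolding computes_in_time_def
proof
  fix x
  from assms(1)[unfolded computes_in_time_def, THEN spec, of x] obtain t where
    "t \<le> T (length x)" "case (step M ^^ t) (init_config M x) of (q, ts) \<Rightarrow>
        (case f x of None \<Rightarrow> q = reject M | Some y \<Rightarrow> q = accept M \<and> snd (last ts) = word_contents y)"
    by (elim exE conjE)
  then show "\<exists>t\<le>T' (length x). case (step M ^^ t) (init_config M x) of (q, ts) \<Rightarrow>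
        (case f x of None \<Rightarrow> q = reject M | Some y \<Rightarrow> q = accept M \<and> snd (last ts) = word_contents y)"
    using assms(2)[of "length x"] by (intro exI[of _ t]) simp
qed

context simulator begin

text \<open>
  The bound \<open>T\<close> also covers the length of the values, in order to have one function to deal with. It
  is a common bound for all generators.
\<close>

definition realizes :: "(nat \<Rightarrow> nat) \<Rightarrow> nat tm \<Rightarrow> (word \<rightharpoonup> word) \<Rightarrow> bool" where
  "realizes T M g \<longleftrightarrow> admissible M \<and> computes_in_time M T g \<and>
     (\<forall>d y. g d = Some y \<longrightarrow> length y \<le> T (length d))"

abbreviation fail :: "nat tm" where
  "fail \<equiv> test (\<lambda>_. False)"

lemma runs_fail: "1 \<le> t \<Longrightarrow> runs fail \<sigma> False \<sigma> t"
  using runs_test[of t "\<lambda>_. False"] by simp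

lemma runs_test_eq: "P (visible \<sigma>) = b \<Longrightarrow> runs (test P) \<sigma> b \<sigma> 1"
  using runs_test[of 1 P \<sigma>] by simp

text \<open>
  Reads one instruction on tape 1 in the way \<open>decode\<close> does and calls the generator. Rejection means that the
  program is over or that the generator was undefined; tape 4 distinguishes the two cases.
\<close>

fun dispatch :: "nat tm list \<Rightarrow> nat tm" where
  "dispatch [] = fail"
| "dispatch (M # Ms) =
     branch (test (\<lambda>r. r 1 = Letter False)) (shift_head 1 MoveRight ;; exec M)
       (branch (test (\<lambda>r. r 1 = Letter True)) (shift_head 1 MoveRight ;; dispatch Ms) fail)"

lemma machine_dispatch: "list_all2 (realizes T) Ms gs \<Longrightarrow> machine (dispatch Ms)"
  by (induction Ms gs rule: list_all2_induct)
    (auto intro!: machine_branch machine_seq machine_test machine_shift_head machine_exec simp: realizes_def)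

lemma runs_dispatch_None:
  assumes "list_all2 (realizes T) Ms gs" "decode gs (drop k x) = None"
    and "\<sigma> 1 = tp (int k) x" "k \<le> length x" "10 * length Ms + 1 \<le> t"
  shows "\<exists>k'\<le>length x. runs (dispatch Ms) \<sigma> False (\<sigma>(1 := tp (int k') x)) t"
  using assms
proof (induction Ms gs arbitrary: k \<sigma> t rule: list_all2_induct)
  case Nil
  then have "\<sigma>(1 := tp (int k) x) = \<sigma>" by auto
  with Nil show ?case by (intro exI[of _ k]) (simp add: runs_fail)
next
  case (Cons M Ms g gs)
  have Ms: "machine (dispatch Ms)" "machine (exec M)"
    using Cons.hyps machine_dispatch by (auto simp: realizes_def machine_exec)
  have vis: "visible \<sigma> 1 = word_contents x (int k)" using Cons.prems(2) by (simp add: visible_def)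
  show ?case
  proof (cases "k < length x")
    case False
    then have sig: "\<sigma>(1 := tp (int k) x) = \<sigma>" "visible \<sigma> 1 = Blank" using Cons.prems(2) vis by auto
    have 1: "runs (test (\<lambda>r. r 1 = Letter False)) \<sigma> False \<sigma> 1"
      and 2: "runs (test (\<lambda>r. r 1 = Letter True)) \<sigma> False \<sigma> 1"
      using sig(2) by (intro runs_test_eq; simp)+
    have 3: "runs (branch (test (\<lambda>r. r 1 = Letter True)) (shift_head 1 MoveRight ;; dispatch Ms) fail) \<sigma> False \<sigma> (1 + 1 + 2)"
      by (rule runs_branch[OF _ _ _ 2]) (auto intro!: machine_seq machine_test machine_shift_head Ms runs_fail)
    have "runs (dispatch (M # Ms)) \<sigma> False \<sigma> t" unfolding dispatch.simps
      by (rule runs_branch[OF _ _ _ 1, of _ _ _ _ "1 + 1 + 2"])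
        (use 3 Cons.prems in \<open>auto intro!: machine_branch machine_seq machine_test machine_shift_head Ms\<close>)
    then show ?thesis using Cons.prems(3) sig by (intro exI[of _ k]) simp
  next
    case True
    then have dr: "drop k x = x ! k # drop (Suc k) x" by (simp add: Cons_nth_drop_Suc)
    with Cons.prems(1) have xk: "x ! k" and dec: "decode gs (drop (Suc k) x) = None"
      by (cases "x ! k"; simp)+
    obtain \<sigma>1 where \<sigma>1_def: "\<sigma>1 = \<sigma>(1 := tp (int (Suc k)) x)" by simp
    have 1: "runs (test (\<lambda>r. r 1 = Letter False)) \<sigma> False \<sigma> 1"
      and 2: "runs (test (\<lambda>r. r 1 = Letter True)) \<sigma> True \<sigma> 1"
      using vis xk True by (intro runs_test_eq; simp)+
    have 3: "runs (shift_head 1 MoveRight) \<sigma> True \<sigma>1 1"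
      using runs_shift_head[of 1 1 MoveRight \<sigma>] Cons.prems(2) by (simp add: \<sigma>1_def tp_def add.commute)
    have \<sigma>1_1: "\<sigma>1 1 = tp (int (Suc k)) x" by (simp add: \<sigma>1_def)
    obtain k' where k': "k' \<le> length x"
      "runs (dispatch Ms) \<sigma>1 False (\<sigma>1(1 := tp (int k') x)) (10 * length Ms + 1)"
      using Cons.IH[where k = "Suc k" and \<sigma> = \<sigma>1, OF dec \<sigma>1_1 Suc_leI[OF True] order_refl] by blast
    have 4: "runs (shift_head 1 MoveRight ;; dispatch Ms) \<sigma> False (\<sigma>(1 := tp (int k') x)) (1 + (10 * length Ms + 1) + 2)"
      using runs_seq[OF machine_shift_head Ms(1) 3 k'(2) order_refl] by (simp add: \<sigma>1_def)
    have 5: "runs (branch (test (\<lambda>r. r 1 = Letter True)) (shift_head 1 MoveRight ;; dispatch Ms) fail) \<sigma> False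
       (\<sigma>(1 := tp (int k') x)) (1 + (1 + (10 * length Ms + 1) + 2) + 2)"
      by (rule runs_branch[OF _ _ _ 2]) (use 4 in \<open>auto intro!: machine_seq machine_test machine_shift_head Ms\<close>)
    have "runs (dispatch (M # Ms)) \<sigma> False (\<sigma>(1 := tp (int k') x)) t" unfolding dispatch.simps
      by (rule runs_branch[OF _ _ _ 1, of _ _ _ _ "1 + (1 + (10 * length Ms + 1) + 2) + 2"])
        (use 5 Cons.prems(4) in \<open>auto intro!: machine_branch machine_seq machine_test machine_shift_head Ms\<close>)
    then show ?thesis using k'(1) by blast
  qed
qed

lemma runs_dispatch_Some:
  assumes "list_all2 (realizes T) Ms gs" "decode gs (drop k x) = Some (g, p)"
    and "\<sigma> 1 = tp (int k) x" "k \<le> length x" "\<sigma> 3 = tp 0 d" "clean \<sigma>"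
    and "10 * length Ms + 10 * (T (length d) + length d) + 110 \<le> t"
  shows "\<exists>\<sigma>' k'. runs (dispatch Ms) \<sigma> (g d \<noteq> None) \<sigma>' t \<and>
    (g d = None \<longrightarrow> symbol_at_head (\<sigma>' 4) \<noteq> Blank) \<and>
    (\<forall>y. g d = Some y \<longrightarrow> \<sigma>' 3 = tp (int (length y)) y \<and> clean \<sigma>') \<and>
    k' \<le> length x \<and> p = drop k' x \<and> \<sigma>' 1 = tp (int k') x \<and>
    (\<forall>j. \<not> on_bank j \<longrightarrow> j \<noteq> 1 \<longrightarrow> j \<noteq> 3 \<longrightarrow> j \<noteq> 4 \<longrightarrow> \<sigma>' j = \<sigma> j)"
  using assms
proof (induction Ms gs arbitrary: k \<sigma> t rule: list_all2_induct)
  case Nil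
  then show ?case by simp
next
  case (Cons M Ms g1 gs)
  have Ms: "machine (dispatch Ms)" "machine (exec M)"
    using Cons.hyps machine_dispatch by (auto simp: realizes_def machine_exec)
  have k: "k < length x"
    using Cons.prems(1,3) by (cases "k < length x") auto
  then have dr: "drop k x = x ! k # drop (Suc k) x" by (simp add: Cons_nth_drop_Suc)
  have vis: "visible \<sigma> 1 = Letter (x ! k)" using Cons.prems(2) k by (simp add: visible_def)
  obtain \<sigma>1 where \<sigma>1_def: "\<sigma>1 = \<sigma>(1 := tp (int (Suc k)) x)" by simp
  have right: "runs (shift_head 1 MoveRight) \<sigma> True \<sigma>1 1"
    using runs_shift_head[of 1 1 MoveRight \<sigma>] Cons.prems(2) by (simp add: \<sigma>1_def tp_def add.commute)
  have \<sigma>1: "\<sigma>1 1 = tp (int (Suc k)) x" "\<sigma>1 3 = tp 0 d" "clean \<sigma>1"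
    and same: "\<And>j. j \<noteq> 1 \<Longrightarrow> \<sigma>1 j = \<sigma> j"
    using Cons.prems(4,5) by (auto simp: clean_def \<sigma>1_def)
  show ?case
  proof (cases "x ! k")
    case False
    with Cons.prems(1) dr have g: "g1 = g" "p = drop (Suc k) x" by auto
    let ?t = "10 * (T (length d) + length d) + 100"
    have real: "admissible M" "computes_in_time M T g" using Cons.hyps g by (auto simp: realizes_def)
    obtain \<sigma>2 where \<sigma>2: "runs (exec M) \<sigma>1 (g d \<noteq> None) \<sigma>2 ?t"
      "g d = None \<Longrightarrow> symbol_at_head (\<sigma>2 4) \<noteq> Blank"
      "\<And>y. g d = Some y \<Longrightarrow> \<sigma>2 3 = tp (int (length y)) y \<and> clean \<sigma>2"
      "\<And>j. \<not> on_bank j \<Longrightarrow> j \<noteq> 3 \<Longrightarrow> j \<noteq> 4 \<Longrightarrow> \<sigma>2 j = \<sigma>1 j"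
      using runs_exec[OF real \<sigma>1(2,3) order_refl] by blast
    have 1: "runs (test (\<lambda>r. r 1 = Letter False)) \<sigma> True \<sigma> 1"
      using vis False by (intro runs_test_eq) simp
    have 2: "runs (shift_head 1 MoveRight ;; exec M) \<sigma> (g d \<noteq> None) \<sigma>2 (1 + ?t + 2)"
      by (rule runs_seq[OF machine_shift_head Ms(2) right \<sigma>2(1) order_refl])
    have "runs (dispatch (M # Ms)) \<sigma> (g d \<noteq> None) \<sigma>2 t" unfolding dispatch.simps
      by (rule runs_branch[OF _ _ _ 1, of _ _ _ _ "1 + ?t + 2"])
        (use 2 Cons.prems(6) in \<open>auto intro!: machine_branch machine_seq machine_test machine_shift_head Ms\<close>)
    then show ?thesis using \<sigma>2(2-4) \<sigma>1(1) same g k by (intro exI[of _ \<sigma>2] exI[of _ "Suc k"]) auto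
  next
    case True
    with Cons.prems(1) dr have dec: "decode gs (drop (Suc k) x) = Some (g, p)" by simp
    let ?t = "10 * length Ms + 10 * (T (length d) + length d) + 110"
    obtain \<sigma>2 k' where \<sigma>2: "runs (dispatch Ms) \<sigma>1 (g d \<noteq> None) \<sigma>2 ?t"
      and post: "g d = None \<longrightarrow> symbol_at_head (\<sigma>2 4) \<noteq> Blank"
      "\<forall>y. g d = Some y \<longrightarrow> \<sigma>2 3 = tp (int (length y)) y \<and> clean \<sigma>2"
      "k' \<le> length x" "p = drop k' x" "\<sigma>2 1 = tp (int k') x"
      "\<forall>j. \<not> on_bank j \<longrightarrow> j \<noteq> 1 \<longrightarrow> j \<noteq> 3 \<longrightarrow> j \<noteq> 4 \<longrightarrow> \<sigma>2 j = \<sigma>1 j"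
      using Cons.IH[where k = "Suc k" and \<sigma> = \<sigma>1, OF dec \<sigma>1(1) Suc_leI[OF k] \<sigma>1(2,3) order_refl]
      by (elim exE conjE) (rule that; assumption)
    have 1: "runs (test (\<lambda>r. r 1 = Letter False)) \<sigma> False \<sigma> 1"
      and 2: "runs (test (\<lambda>r. r 1 = Letter True)) \<sigma> True \<sigma> 1"
      using vis True by (intro runs_test_eq; simp)+
    have 4: "runs (shift_head 1 MoveRight ;; dispatch Ms) \<sigma> (g d \<noteq> None) \<sigma>2 (1 + ?t + 2)"
      by (rule runs_seq[OF machine_shift_head Ms(1) right \<sigma>2 order_refl])
    have 5: "runs (branch (test (\<lambda>r. r 1 = Letter True)) (shift_head 1 MoveRight ;; dispatch Ms) fail) \<sigma> (g d \<noteq> None)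
       \<sigma>2 (1 + (1 + ?t + 2) + 2)"
      by (rule runs_branch[OF _ _ _ 2]) (use 4 in \<open>auto intro!: machine_seq machine_test machine_shift_head Ms\<close>)
    have "runs (dispatch (M # Ms)) \<sigma> (g d \<noteq> None) \<sigma>2 t" unfolding dispatch.simps
      by (rule runs_branch[OF _ _ _ 1, of _ _ _ _ "1 + (1 + ?t + 2) + 2"])
        (use 5 Cons.prems(6) in \<open>auto intro!: machine_branch machine_seq machine_test machine_shift_head Ms\<close>)
    then show ?thesis using post same by (intro exI[of _ \<sigma>2] exI[of _ k']) auto
  qed
qed

text \<open>
  Compares the lengths of the words on tapes 3 and 2. If the comparison succeeds, the heads are put
  back to where the next call expects them.
\<close>

definition fits :: "nat tm" where
  "fits = rewind 3 ;; rewind 2 ;;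
     sweep (\<lambda>r. r 3 \<noteq> Blank \<and> r 2 \<noteq> Blank) (\<lambda>r. (idle r)(2 := (r 2, MoveRight), 3 := (r 3, MoveRight))) ;;
     branch (test (\<lambda>r. r 3 = Blank)) (to_end 2 ;; rewind 3) fail"

lemma machine_fits: "machine fits"
  unfolding fits_def by (intro machine_rules machine_rewind machine_branch machine_to_end)

lemma runs_fits:
  assumes \<sigma>: "\<sigma> 2 = tp (int (length l)) l" "\<sigma> 3 = tp (int (length y)) y"
    and t: "4 * (length y + length l) + 60 \<le> t"
  shows "runs fits \<sigma> (length y \<le> length l)
    (\<sigma>(3 := tp (if length y \<le> length l then 0 else int (length l)) y)) t"
proof -
  let ?n = "min (length y) (length l)"
  let ?\<tau> = "\<lambda>i. \<sigma>(2 := tp (int i) l, 3 := tp (int i) y)"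
  let ?S = "sweep (\<lambda>r. r 3 \<noteq> Blank \<and> r 2 \<noteq> Blank) (\<lambda>r. (idle r)(2 := (r 2, MoveRight), 3 := (r 3, MoveRight)))"
  let ?B = "branch (test (\<lambda>r. r 3 = Blank)) (to_end 2 ;; rewind 3) fail"
  let ?\<sigma>' = "\<sigma>(3 := tp (if length y \<le> length l then 0 else int (length l)) y)"
  have 1: "runs (rewind 3) \<sigma> True (\<sigma>(3 := tp 0 y)) (length y + 10)"
    using \<sigma>(2) by (rule runs_rewind) auto
  have 2: "runs (rewind 2) (\<sigma>(3 := tp 0 y)) True (?\<tau> 0) (length l + 10)"
    using runs_rewind[of "\<sigma>(3 := tp 0 y)" 2 "length l" l] \<sigma>(1) by (simp add: fun_upd_twist)
  have 3: "runs ?S (?\<tau> 0) True (?\<tau> ?n) (?n + 1)"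
    by (rule runs_sweep) (auto simp: tape_simps add.commute simp del: act.simps)
  have "runs ?B (?\<tau> ?n) (length y \<le> length l) ?\<sigma>' (1 + (length y + length l + 13) + 2)"
  proof (cases "length y \<le> length l")
    case True
    have a: "runs (to_end 2) (?\<tau> ?n) True (\<sigma>(3 := tp (int (length y)) y)) (length l + 1)"
    proof -
      have "(?\<tau> ?n)(2 := tp (int (length l)) l) = \<sigma>(3 := tp (int (length y)) y)"
        using True \<sigma>(1) by (auto simp: fun_eq_iff)
      with runs_to_end[of "?\<tau> ?n" 2 ?n l] show ?thesis by simp
    qed
    have b: "runs (rewind 3) (\<sigma>(3 := tp (int (length y)) y)) True ?\<sigma>' (length y + 10)"
      using runs_rewind[of "\<sigma>(3 := tp (int (length y)) y)" 3 "length y" y] True by simp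
    from runs_seq[OF machine_to_end machine_rewind a b order_refl]
    have c: "runs (to_end 2 ;; rewind 3) (?\<tau> ?n) True ?\<sigma>' (length y + length l + 13)" by (simp add: algebra_simps)
    have "runs (test (\<lambda>r. r 3 = Blank)) (?\<tau> ?n) True (?\<tau> ?n) 1"
      using runs_test[of 1 "\<lambda>r. r 3 = Blank" "?\<tau> ?n"] True by (simp add: visible_def)
    then show ?thesis
      by (rule runs_branch[OF machine_test machine_seq[OF machine_to_end machine_rewind] machine_test _ _ order_refl])
        (use c True in simp)
  next
    case False
    then have eq: "?\<sigma>' = ?\<tau> ?n" using \<sigma>(1) by (auto simp: fun_eq_iff)
    have "runs (test (\<lambda>r. r 3 = Blank)) (?\<tau> ?n) False (?\<tau> ?n) 1"
      using runs_test[of 1 "\<lambda>r. r 3 = Blank" "?\<tau> ?n"] False by (simp add: visible_def)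
    then show ?thesis unfolding eq
      by (rule runs_branch[OF machine_test machine_seq[OF machine_to_end machine_rewind] machine_test _ _ order_refl])
        (use False in \<open>simp add: runs_fail\<close>)
  qed
  note 4 = this
  show ?thesis unfolding fits_def
    by (rule runs_seq[OF _ _ 1 runs_seq[OF _ _ 2 runs_seq[OF _ _ 3 4 order_refl] order_refl]])
      (use t in \<open>auto intro!: machine_rules machine_rewind machine_branch machine_to_end\<close>)
qed

text \<open>
  The run of a program. The loop ends in any case; whether the program has escaped is shown by
  tape 4.
\<close>

definition search :: "nat tm list \<Rightarrow> nat tm" where
  "search Ms = loop (branch (dispatch Ms) fits fail)"

lemma machine_search: "list_all2 (realizes T) Ms gs \<Longrightarrow> machine (search Ms)"
  unfolding search_def by (intro machine_loop machine_branch machine_dispatch machine_fits machine_test)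

text \<open>
  Induction on the unread part of the program. Only values of length at most \<open>length l\<close> are ever
  passed to a generator, so the time of a round is bounded in terms of \<open>length l\<close> and the number
  of generators. If there is no escape, the heads of tapes 1 and 3 end somewhere on their words, which is
  enough for tidying up.
\<close>

lemma runs_search:
  assumes real: "list_all2 (realizes T) Ms gs" and T: "mono T"
    and "\<sigma> 1 = tp (int k) x" "k \<le> length x" "\<sigma> 2 = tp (int (length l)) l" "\<sigma> 3 = tp 0 d" "clean \<sigma>"
    and "length d \<le> length l"
    and "(length x - k + 1) * (20 * (T (length l) + length l + length Ms) + 300) \<le> t"
  shows "\<exists>\<sigma>'. runs (search Ms) \<sigma> True \<sigma>' t \<and>
    (if escape gs (length l) (drop k x) d then symbol_at_head (\<sigma>' 4) \<noteq> Blank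
     else clean \<sigma>' \<and> \<sigma>' 2 = \<sigma> 2 \<and> (\<exists>k'\<le>length x. \<sigma>' 1 = tp (int k') x) \<and>
       (\<exists>i d'. i \<le> length d' \<and> length d' \<le> T (length l) + length l \<and> \<sigma>' 3 = tp (int i) d')) \<and>
    (\<forall>j. \<not> on_bank j \<longrightarrow> j \<noteq> 1 \<longrightarrow> j \<noteq> 2 \<longrightarrow> j \<noteq> 3 \<longrightarrow> j \<noteq> 4 \<longrightarrow> \<sigma>' j = \<sigma> j)"
  using assms(3-)
proof (induction "length x - k" arbitrary: k d \<sigma> t rule: less_induct)
  case less
  let ?turn = "branch (dispatch Ms) fits fail"
  let ?R = "T (length l)"
  let ?b = "20 * (?R + length l + length Ms) + 300"
  have mach: "machine (dispatch Ms)" "machine ?turn"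
    using real by (auto intro!: machine_branch machine_dispatch machine_fits machine_test)
  have Td: "T (length d) \<le> ?R" using less.prems(6) T by (simp add: mono_def)
  have tb: "?b \<le> t" using less.prems(7) by (simp add: algebra_simps)
  note esc = escape.simps[of gs "length l" "drop k x" d]
  show ?case
  proof (cases "decode gs (drop k x)")
    case None
    from runs_dispatch_None[where k = k and x = x and \<sigma> = \<sigma>, OF real None less.prems(1,2), of "10 * length Ms + 1"] obtain k'
      where k': "k' \<le> length x"
        "runs (dispatch Ms) \<sigma> False (\<sigma>(1 := tp (int k') x)) (10 * length Ms + 1)" by auto
    have "runs ?turn \<sigma> False (\<sigma>(1 := tp (int k') x)) t"
      by (rule runs_branch[OF mach(1) machine_fits machine_test k'(2), where ?t2.0 = 1])
        (use tb in \<open>auto intro: runs_fail\<close>)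
    then have "runs (search Ms) \<sigma> True (\<sigma>(1 := tp (int k') x)) t"
      unfolding search_def by (rule runs_loop_exit)
    moreover have "\<not> escape gs (length l) (drop k x) d" by (simp add: esc None)
    moreover have "clean (\<sigma>(1 := tp (int k') x))" using less.prems(5) by (auto simp: clean_def)
    moreover have "\<exists>i d'. i \<le> length d' \<and> length d' \<le> ?R + length l \<and> \<sigma> 3 = tp (int i) d'"
      using less.prems(4,6) by (intro exI[of _ 0] exI[of _ d]) simp
    ultimately show ?thesis using k'(1)
      by (intro exI[of _ "\<sigma>(1 := tp (int k') x)"]) auto
  next
    case (Some gp)
    then obtain g p where dec: "decode gs (drop k x) = Some (g, p)" by (cases gp) auto
    let ?t = "10 * length Ms + 10 * (?R + length l) + 110"
    have "10 * length Ms + 10 * (T (length d) + length d) + 110 \<le> ?t" using Td less.prems(6) by simp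
    from runs_dispatch_Some[where k = k and x = x and \<sigma> = \<sigma>, OF real dec less.prems(1,2,4,5) this]
    obtain \<sigma>1 k' where \<sigma>1: "runs (dispatch Ms) \<sigma> (g d \<noteq> None) \<sigma>1 ?t"
      and post: "g d = None \<longrightarrow> symbol_at_head (\<sigma>1 4) \<noteq> Blank"
      "\<forall>y. g d = Some y \<longrightarrow> \<sigma>1 3 = tp (int (length y)) y \<and> clean \<sigma>1"
      "k' \<le> length x" "p = drop k' x" "\<sigma>1 1 = tp (int k') x"
      "\<forall>j. \<not> on_bank j \<longrightarrow> j \<noteq> 1 \<longrightarrow> j \<noteq> 3 \<longrightarrow> j \<noteq> 4 \<longrightarrow> \<sigma>1 j = \<sigma> j" by (elim exE conjE) (rule that; assumption)
    show ?thesis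
    proof (cases "g d")
      case None
      have "runs ?turn \<sigma> False \<sigma>1 t"
        by (rule runs_branch[OF mach(1) machine_fits machine_test \<sigma>1, where ?t2.0 = 1])
          (use tb None in \<open>auto intro: runs_fail\<close>)
      then have "runs (search Ms) \<sigma> True \<sigma>1 t" unfolding search_def by (rule runs_loop_exit)
      moreover have "escape gs (length l) (drop k x) d" by (simp add: esc dec None)
      ultimately show ?thesis using post None by (intro exI[of _ \<sigma>1]) auto
    next
      case (Some y)
      have \<sigma>13: "\<sigma>1 3 = tp (int (length y)) y" and cl: "clean \<sigma>1" using post(2) Some by auto
      have \<sigma>12: "\<sigma>1 2 = tp (int (length l)) l" using post(6) less.prems(3) by simp
      have "g \<in> set gs" using decode_mem[OF dec] .
      then have "length y \<le> T (length d)" using real Some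
        by (auto simp: list_all2_conv_all_nth realizes_def in_set_conv_nth)
      then have yR: "length y \<le> ?R" using Td by simp
      let ?\<sigma>2 = "\<sigma>1(3 := tp (if length y \<le> length l then 0 else int (length l)) y)"
      let ?f = "4 * (?R + length l) + 60"
      have "runs fits \<sigma>1 (length y \<le> length l) ?\<sigma>2 ?f" using yR by (intro runs_fits[OF \<sigma>12 \<sigma>13]) simp
      then have turn: "runs ?turn \<sigma> (length y \<le> length l) ?\<sigma>2 (?t + ?f + 2)"
        by (intro runs_branch[OF mach(1) machine_fits machine_test \<sigma>1]) (auto simp: Some)
      have cl2: "clean ?\<sigma>2" using cl by (auto simp: clean_def)
      show ?thesis
      proof (cases "length y \<le> length l")
        case False
        have "runs (search Ms) \<sigma> True ?\<sigma>2 (?t + ?f + 2)"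
          using turn False unfolding search_def by (intro runs_loop_exit) simp
        then have "runs (search Ms) \<sigma> True ?\<sigma>2 t" by (rule runs_mono) (use tb in simp)
        moreover have "\<not> escape gs (length l) (drop k x) d" by (simp add: esc dec Some False)
        moreover have "\<exists>i d'. i \<le> length d' \<and> length d' \<le> ?R + length l \<and> ?\<sigma>2 3 = tp (int i) d'"
          using False yR by (intro exI[of _ "length l"] exI[of _ y]) simp
        ultimately show ?thesis using cl2 post(3,5,6) \<sigma>12 less.prems(3)
          by (intro exI[of _ ?\<sigma>2]) auto
      next
        case True
        let ?\<sigma>3 = "\<sigma>1(3 := tp 0 y)"
        have eq: "?\<sigma>2 = ?\<sigma>3" using True by simp
        have lt: "length x - k' < length x - k" using decode_length[OF dec] post(3,4) by simp
        let ?t' = "(length x - k' + 1) * ?b"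
        have "\<exists>\<sigma>'. runs (search Ms) ?\<sigma>3 True \<sigma>' ?t' \<and>
          (if escape gs (length l) (drop k' x) y then symbol_at_head (\<sigma>' 4) \<noteq> Blank
           else clean \<sigma>' \<and> \<sigma>' 2 = ?\<sigma>3 2 \<and> (\<exists>k'\<le>length x. \<sigma>' 1 = tp (int k') x) \<and>
             (\<exists>i d'. i \<le> length d' \<and> length d' \<le> ?R + length l \<and> \<sigma>' 3 = tp (int i) d')) \<and>
          (\<forall>j. \<not> on_bank j \<longrightarrow> j \<noteq> 1 \<longrightarrow> j \<noteq> 2 \<longrightarrow> j \<noteq> 3 \<longrightarrow> j \<noteq> 4 \<longrightarrow> \<sigma>' j = ?\<sigma>3 j)"
          using cl2 post(3,5) \<sigma>12 True unfolding eq by (intro less.hyps[OF lt]) auto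
        then obtain \<sigma>' where \<sigma>': "runs (search Ms) ?\<sigma>3 True \<sigma>' ?t'"
          "if escape gs (length l) (drop k' x) y then symbol_at_head (\<sigma>' 4) \<noteq> Blank
           else clean \<sigma>' \<and> \<sigma>' 2 = ?\<sigma>3 2 \<and> (\<exists>k'\<le>length x. \<sigma>' 1 = tp (int k') x) \<and>
             (\<exists>i d'. i \<le> length d' \<and> length d' \<le> ?R + length l \<and> \<sigma>' 3 = tp (int i) d')"
          "\<forall>j. \<not> on_bank j \<longrightarrow> j \<noteq> 1 \<longrightarrow> j \<noteq> 2 \<longrightarrow> j \<noteq> 3 \<longrightarrow> j \<noteq> 4 \<longrightarrow> \<sigma>' j = ?\<sigma>3 j" by blast
        have "(length x - k' + 1 + 1) * ?b \<le> (length x - k + 1) * ?b"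
          using lt by (intro mult_right_mono) auto
        then have time: "?t + ?f + 2 + ?t' + 1 \<le> t" using less.prems(7) by (simp add: algebra_simps)
        have "runs (search Ms) \<sigma> True \<sigma>' t"
          using runs_loop_again[OF mach(2) _ \<sigma>'(1)[unfolded search_def] time] turn True
          unfolding search_def by (simp add: eq)
        moreover have "escape gs (length l) (drop k x) d \<longleftrightarrow> escape gs (length l) (drop k' x) y"
          by (simp add: esc dec Some True post(4))
        ultimately show ?thesis using \<sigma>'(2,3) post(6) \<sigma>12 less.prems(3) by (intro exI[of _ \<sigma>']) auto
      qed
    qed
  qed
qed

text \<open>
  Runs the program \<open>x\<close> on the datum \<open>x\<close>. An escape is reported by rejection, so that it ends the
  loop over the prefixes.
\<close>

definition check :: "nat tm list \<Rightarrow> nat tm" where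
  "check Ms =
     rewind 1 ;;
     sweep (\<lambda>r. r 1 \<noteq> Blank) (\<lambda>r. (idle r)(1 := (r 1, MoveRight), 3 := (r 1, MoveRight))) ;;
     rewind 1 ;; rewind 3 ;; search Ms ;;
     branch (test (\<lambda>r. r 4 \<noteq> Blank)) fail (to_end 1 ;; to_end 3 ;; erase 3)"

definition ready :: "tapes \<Rightarrow> word \<Rightarrow> bool" where
  "ready \<sigma> x \<longleftrightarrow> \<sigma> 1 = tp (int (length x)) x \<and>
     \<sigma> 2 = tp (int (2 * length x)) (replicate (2 * length x) True) \<and> \<sigma> 3 = tp 0 [] \<and> clean \<sigma>"

lemma machine_check: "list_all2 (realizes T) Ms gs \<Longrightarrow> machine (check Ms)"
  unfolding check_def
  by (intro machine_rules machine_rewind machine_search machine_branch machine_to_end machine_erase)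

lemma runs_check:
  assumes real: "list_all2 (realizes T) Ms gs" and T: "mono T" and \<sigma>: "ready \<sigma> x"
    and t: "(length x + 1) * (20 * (T (2 * length x) + 2 * length x + length Ms) + 300)
       + 10 * (T (2 * length x) + length x) + 100 \<le> t"
  shows "\<exists>\<sigma>'. runs (check Ms) \<sigma> (\<not> escape gs (2 * length x) x x) \<sigma>' t \<and>
    (if escape gs (2 * length x) x x then symbol_at_head (\<sigma>' 4) \<noteq> Blank else ready \<sigma>' x) \<and>
    \<sigma>' 0 = \<sigma> 0 \<and> \<sigma>' (5 + K) = \<sigma> (5 + K)"
proof -
  let ?n = "length x" and ?l = "replicate (2 * length x) True"
  let ?R = "T (2 * ?n)"
  let ?b = "(?n + 1) * (20 * (?R + 2 * ?n + length Ms) + 300)"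
  let ?C = "sweep (\<lambda>r. r 1 \<noteq> Blank) (\<lambda>r. (idle r)(1 := (r 1, MoveRight), 3 := (r 1, MoveRight)))"
  let ?E = "branch (test (\<lambda>r. r 4 \<noteq> Blank)) fail (to_end 1 ;; to_end 3 ;; erase 3)"
  note mach = machine_rules machine_rewind machine_search[OF real] machine_branch machine_to_end machine_erase
  have \<sigma>1: "\<sigma> 1 = tp (int ?n) x" and \<sigma>2: "\<sigma> 2 = tp (int (length ?l)) ?l" and \<sigma>3: "\<sigma> 3 = tp 0 []"
    and cl: "clean \<sigma>" using \<sigma> by (auto simp: ready_def)
  let ?\<tau> = "\<lambda>i. \<sigma>(1 := tp (int i) x, 3 := tp (int i) (take i x))"
  have "\<sigma>(1 := tp 0 x) = ?\<tau> 0" using \<sigma>3 by (auto simp: fun_eq_iff)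
  with runs_rewind[of \<sigma> 1 ?n x] \<sigma>1 have 1: "runs (rewind 1) \<sigma> True (?\<tau> 0) (?n + 10)" by simp
  have copy: "act (Letter (x ! i), MoveRight) (tp (int i) (take i x)) = tp (int (Suc i)) (take (Suc i) x)"
    if "i < ?n" for i
    using act_snoc[of "x ! i" "take i x"] that by (simp add: take_Suc_conv_app_nth del: act.simps)
  have 2: "runs ?C (?\<tau> 0) True (?\<tau> ?n) (?n + 1)"
    using copy by (intro runs_sweep) (auto simp: tape_simps add.commute simp del: act.simps)
  have 3: "runs (rewind 1) (?\<tau> ?n) True (\<sigma>(1 := tp 0 x, 3 := tp (int ?n) x)) (?n + 10)"
    using runs_rewind[of "?\<tau> ?n" 1 ?n x] by (simp add: fun_upd_twist)
  obtain \<rho> where \<rho>_def: "\<rho> = \<sigma>(1 := tp 0 x, 3 := tp 0 x)" by simp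
  have 4: "runs (rewind 3) (\<sigma>(1 := tp 0 x, 3 := tp (int ?n) x)) True \<rho> (?n + 10)"
    using runs_rewind[of "\<sigma>(1 := tp 0 x, 3 := tp (int ?n) x)" 3 ?n x] by (simp add: \<rho>_def)
  have \<rho>: "\<rho> 1 = tp (int 0) x" "\<rho> 2 = tp (int (length ?l)) ?l" "\<rho> 3 = tp 0 x" "clean \<rho>"
    using \<sigma>2 cl by (auto simp: \<rho>_def clean_def)
  obtain \<sigma>' where \<sigma>': "runs (search Ms) \<rho> True \<sigma>' ?b"
    "if escape gs (2 * ?n) x x then symbol_at_head (\<sigma>' 4) \<noteq> Blank
     else clean \<sigma>' \<and> \<sigma>' 2 = \<rho> 2 \<and> (\<exists>k'\<le>?n. \<sigma>' 1 = tp (int k') x) \<and>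
       (\<exists>i d'. i \<le> length d' \<and> length d' \<le> ?R + 2 * ?n \<and> \<sigma>' 3 = tp (int i) d')"
    "\<forall>j. \<not> on_bank j \<longrightarrow> j \<noteq> 1 \<longrightarrow> j \<noteq> 2 \<longrightarrow> j \<noteq> 3 \<longrightarrow> j \<noteq> 4 \<longrightarrow> \<sigma>' j = \<rho> j"
  proof -
    have "(?n - 0 + 1) * (20 * (T (length ?l) + length ?l + length Ms) + 300) \<le> ?b" "?n \<le> length ?l" by simp_all
    from runs_search[where k = 0 and x = x and l = ?l and \<sigma> = \<rho> and d = x,
        OF real T \<rho>(1) le0 \<rho>(2-4) this(2,1), unfolded length_replicate drop_0]
    show thesis by (elim exE conjE) (rule that; assumption)
  qed
  have keep: "\<sigma>' 0 = \<sigma> 0" "\<sigma>' (5 + K) = \<sigma> (5 + K)" using \<sigma>'(3) by (auto simp: \<rho>_def)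
  let ?e = "2 * (?R + 2 * ?n) + ?n + 30"
  have "\<exists>\<sigma>''. runs ?E \<sigma>' (\<not> escape gs (2 * ?n) x x) \<sigma>'' ?e \<and>
    (if escape gs (2 * ?n) x x then symbol_at_head (\<sigma>'' 4) \<noteq> Blank else ready \<sigma>'' x) \<and>
    \<sigma>'' 0 = \<sigma> 0 \<and> \<sigma>'' (5 + K) = \<sigma> (5 + K)"
  proof (cases "escape gs (2 * ?n) x x")
    case True
    have "runs (test (\<lambda>r. r 4 \<noteq> Blank)) \<sigma>' True \<sigma>' 1"
      using \<sigma>'(2) True by (intro runs_test_eq) (simp add: visible_def)
    then have "runs ?E \<sigma>' False \<sigma>' ?e"
      by (rule runs_branch[where ?t2.0 = 1, rotated 3]) (auto intro!: mach runs_fail)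
    then show ?thesis using True \<sigma>'(2) keep by auto
  next
    case False
    with \<sigma>'(2) obtain k i d where post: "clean \<sigma>'" "\<sigma>' 2 = \<rho> 2" "k \<le> ?n" "\<sigma>' 1 = tp (int k) x"
      "i \<le> length d" "length d \<le> ?R + 2 * ?n" "\<sigma>' 3 = tp (int i) d" by auto
    have a: "runs (test (\<lambda>r. r 4 \<noteq> Blank)) \<sigma>' False \<sigma>' 1"
      using post(1) by (intro runs_test_eq) (simp add: visible_def clean_def word_contents_Nil)
    have b: "runs (to_end 1) \<sigma>' True (\<sigma>'(1 := tp (int ?n) x)) (?n + 1)"
      using post by (intro runs_to_end) auto
    have c: "runs (to_end 3) (\<sigma>'(1 := tp (int ?n) x)) True
        (\<sigma>'(1 := tp (int ?n) x, 3 := tp (int (length d)) d)) (length d + 1)"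
      using post by (intro runs_to_end) auto
    have "runs (erase 3) (\<sigma>'(1 := tp (int ?n) x, 3 := tp (int (length d)) d)) True
        (\<sigma>'(1 := tp (int ?n) x, 3 := tp (int (length d)) d, 3 := tp 0 [])) (length d + 10)"
      by (intro runs_erase) auto
    then have d: "runs (erase 3) (\<sigma>'(1 := tp (int ?n) x, 3 := tp (int (length d)) d)) True
        (\<sigma>'(1 := tp (int ?n) x, 3 := tp 0 [])) (length d + 10)" by simp
    have bcd: "runs (to_end 1 ;; to_end 3 ;; erase 3) \<sigma>' True (\<sigma>'(1 := tp (int ?n) x, 3 := tp 0 []))
        (?n + 1 + (length d + 1 + (length d + 10) + 2) + 2)"
      by (rule runs_seq[OF _ _ b runs_seq[OF _ _ c d order_refl] order_refl]) (auto intro!: mach)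
    have "runs ?E \<sigma>' True (\<sigma>'(1 := tp (int ?n) x, 3 := tp 0 [])) ?e"
      by (rule runs_branch[OF _ _ _ a, where ?t2.0 = "?n + 1 + (length d + 1 + (length d + 10) + 2) + 2"])
        (use bcd post(6) in \<open>auto intro!: mach\<close>)
    moreover have "ready (\<sigma>'(1 := tp (int ?n) x, 3 := tp 0 [])) x"
      using post(1,2) \<rho>(2) by (auto simp: ready_def clean_def)
    ultimately show ?thesis using False keep by (intro exI[of _ "\<sigma>'(1 := tp (int ?n) x, 3 := tp 0 [])"]) auto
  qed
  then obtain \<sigma>'' where \<sigma>'': "runs ?E \<sigma>' (\<not> escape gs (2 * ?n) x x) \<sigma>'' ?e"
    "if escape gs (2 * ?n) x x then symbol_at_head (\<sigma>'' 4) \<noteq> Blank else ready \<sigma>'' x"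
    "\<sigma>'' 0 = \<sigma> 0" "\<sigma>'' (5 + K) = \<sigma> (5 + K)" by (elim exE conjE) (rule that; assumption)
  have "runs (check Ms) \<sigma> (\<not> escape gs (2 * ?n) x x) \<sigma>'' t" unfolding check_def
    by (rule runs_seq[OF _ _ 1 runs_seq[OF _ _ 2 runs_seq[OF _ _ 3 runs_seq[OF _ _ 4
          runs_seq[OF _ _ \<sigma>'(1) \<sigma>''(1) order_refl] order_refl] order_refl] order_refl]])
      (use t in \<open>auto intro!: mach\<close>)
  then show ?thesis using \<sigma>''(2-) by blast
qed

text \<open>
  Proceeds to the next prefix. The bound on tape 2 grows by two marks.
\<close>

definition advance :: "nat tm" where
  "advance =
     once (\<lambda>r. (idle r)(0 := (r 0, MoveRight), 1 := (r 0, MoveRight), 2 := (Letter True, MoveRight),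
                   5 + K := (r 0, MoveRight))) ;;
     once (\<lambda>r. (idle r)(2 := (Letter True, MoveRight)))"

lemma machine_advance: "machine advance"
  unfolding advance_def by (intro machine_rules)

definition scanned :: "tapes \<Rightarrow> word \<Rightarrow> nat \<Rightarrow> bool" where
  "scanned \<sigma> z i \<longleftrightarrow> i \<le> length z \<and> \<sigma> 0 = tp (int i) z \<and> \<sigma> (5 + K) = tp (int i) (take i z)"

lemma runs_advance:
  assumes \<sigma>: "scanned \<sigma> z i" "ready \<sigma> (take i z)" and i: "i < length z"
  shows "\<exists>\<sigma>'. runs advance \<sigma> True \<sigma>' 4 \<and> scanned \<sigma>' z (Suc i) \<and> ready \<sigma>' (take (Suc i) z)"
proof -
  let ?l = "\<lambda>n. tp (int n) (replicate n True)"
  let ?x = "tp (int (Suc i)) (take (Suc i) z)"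
  let ?A = "\<lambda>r. (idle r)(0 := (r 0, MoveRight), 1 := (r 0, MoveRight), 2 := (Letter True, MoveRight),
                   5 + K := (r 0, MoveRight))"
  let ?B = "\<lambda>r. (idle r)(2 := (Letter True, MoveRight))"
  have K: "5 + K < N" by (simp add: N_eq)
  have mark: "act (Letter True, MoveRight) (?l n) = ?l (Suc n)" for n
    using act_snoc[of True "replicate n True"] by (simp add: replicate_append_same del: act.simps)
  have letter: "act (Letter (z ! i), MoveRight) (tp (int i) (take i z)) = ?x"
    using act_snoc[of "z ! i" "take i z"] i by (simp add: take_Suc_conv_app_nth del: act.simps)
  have s: "\<sigma> 0 = tp (int i) z" "\<sigma> (5 + K) = tp (int i) (take i z)" "\<sigma> 1 = tp (int i) (take i z)"
    "\<sigma> 2 = ?l (2 * i)" "\<sigma> 3 = tp 0 []" "clean \<sigma>"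
    using \<sigma> i by (auto simp: scanned_def ready_def)
  let ?\<sigma>1 = "\<sigma>(0 := tp (int (Suc i)) z, 1 := ?x, 2 := ?l (Suc (2 * i)), 5 + K := ?x)"
  let ?\<sigma>2 = "\<sigma>(0 := tp (int (Suc i)) z, 1 := ?x, 2 := ?l (Suc (Suc (2 * i))), 5 + K := ?x)"
  have "perform ?A \<sigma> = ?\<sigma>1"
  proof
    fix j
    show "perform ?A \<sigma> j = ?\<sigma>1 j"
      using s K i mark[of "2 * i"] letter
      by (auto simp: perform_def visible_def idle_def add.commute simp del: act.simps)
  qed
  then have 1: "runs (once ?A) \<sigma> True ?\<sigma>1 1" by (rule runs_once_eq)
  have "perform ?B ?\<sigma>1 = ?\<sigma>2"
  proof
    fix j
    show "perform ?B ?\<sigma>1 j = ?\<sigma>2 j"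
      using K mark[of "Suc (2 * i)"]
      by (auto simp: perform_def visible_def idle_def simp del: act.simps)
  qed
  then have 2: "runs (once ?B) ?\<sigma>1 True ?\<sigma>2 1" by (rule runs_once_eq)
  have "runs advance \<sigma> True ?\<sigma>2 4" unfolding advance_def
    by (rule runs_seq[OF _ _ 1 2]) (auto intro!: machine_rules)
  moreover have "scanned ?\<sigma>2 z (Suc i)" using i by (simp add: scanned_def)
  moreover have "clean ?\<sigma>2" using s(6) by (auto simp: clean_def)
  then have "ready ?\<sigma>2 (take (Suc i) z)" using i s(5) by (simp add: ready_def)
  ultimately show ?thesis by blast
qed

text \<open>
  The loop over the nonempty prefixes of the input. It ends at the first escape or at the end of the input.
\<close>

definition scan :: "nat tm list \<Rightarrow> nat tm" where
  "scan Ms = loop (branch (test (\<lambda>r. r 0 \<noteq> Blank)) (advance ;; check Ms) fail)"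

lemma machine_scan: "list_all2 (realizes T) Ms gs \<Longrightarrow> machine (scan Ms)"
  unfolding scan_def by (intro machine_loop machine_branch machine_seq machine_advance machine_check machine_test)

lemma runs_scan:
  assumes real: "list_all2 (realizes T) Ms gs" and T: "mono T"
    and "scanned \<sigma> z i" "ready \<sigma> (take i z)"
    and "(length z - i + 1) * ((length z + 3) * (20 * (T (2 * length z) + 2 * length z + length Ms) + 300)) \<le> t"
  shows "\<exists>\<sigma>' k. runs (scan Ms) \<sigma> True \<sigma>' t \<and> scanned \<sigma>' z k \<and>
    (symbol_at_head (\<sigma>' 4) \<noteq> Blank \<longleftrightarrow>
       (\<exists>j. i < j \<and> j \<le> length z \<and> escape gs (2 * j) (take j z) (take j z)))"
  using assms(3-)
proof (induction "length z - i" arbitrary: i \<sigma> t)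
  case 0
  let ?body = "branch (test (\<lambda>r. r 0 \<noteq> Blank)) (advance ;; check Ms) fail"
  have i: "i = length z" using 0 by (simp add: scanned_def)
  have a: "runs (test (\<lambda>r. r 0 \<noteq> Blank)) \<sigma> False \<sigma> 1"
    using 0(2) i by (intro runs_test_eq) (simp add: visible_def scanned_def)
  have "3 * 300 \<le> (length z + 3) * (20 * (T (2 * length z) + 2 * length z + length Ms) + 300)"
    by (intro mult_mono) auto
  also have "\<dots> \<le> t" using 0(4) i by simp
  finally have "4 \<le> t" by simp
  have "runs ?body \<sigma> False \<sigma> t"
    by (rule runs_branch[OF _ _ _ a, where ?t2.0 = 1])
      (use \<open>4 \<le> t\<close> real in \<open>auto intro!: machine_seq machine_advance machine_check machine_test runs_fail\<close>)
  then have "runs (scan Ms) \<sigma> True \<sigma> t" unfolding scan_def by (rule runs_loop_exit)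
  moreover have "symbol_at_head (\<sigma> 4) = Blank"
    using 0(3) by (simp add: ready_def clean_def word_contents_Nil)
  ultimately show ?case using 0(2) i by (intro exI[of _ \<sigma>] exI[of _ i]) auto
next
  case (Suc m)
  let ?body = "branch (test (\<lambda>r. r 0 \<noteq> Blank)) (advance ;; check Ms) fail"
  let ?n = "length z"
  let ?u = "20 * (T (2 * ?n) + 2 * ?n + length Ms) + 300"
  let ?b = "(?n + 3) * ?u"
  let ?esc = "\<lambda>j. escape gs (2 * j) (take j z) (take j z)"
  have mach: "machine (check Ms)" "machine ?body"
    using real by (auto intro!: machine_branch machine_seq machine_advance machine_check machine_test)
  have i: "i < ?n" using Suc(2) by simp
  have a: "runs (test (\<lambda>r. r 0 \<noteq> Blank)) \<sigma> True \<sigma> 1"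
    using Suc(3) i by (intro runs_test_eq) (simp add: visible_def scanned_def)
  from runs_advance[OF Suc(3,4) i] obtain \<sigma>1 where
    \<sigma>1: "runs advance \<sigma> True \<sigma>1 4" "scanned \<sigma>1 z (Suc i)" "ready \<sigma>1 (take (Suc i) z)" by blast
  have len: "length (take (Suc i) z) = Suc i" using i by simp
  let ?c = "(?n + 1) * ?u + 10 * (T (2 * ?n) + ?n) + 100"
  have "T (2 * Suc i) \<le> T (2 * ?n)" using i by (intro monoD[OF T]) simp
  then have "(Suc i + 1) * (20 * (T (2 * Suc i) + 2 * Suc i + length Ms) + 300)
       + 10 * (T (2 * Suc i) + Suc i) + 100 \<le> ?c"
    using i by (intro add_mono mult_mono) auto
  note found = runs_check[OF real T \<sigma>1(3), unfolded len, OF this]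
  obtain \<sigma>2 where \<sigma>2: "runs (check Ms) \<sigma>1 (\<not> ?esc (Suc i)) \<sigma>2 ?c"
    "if ?esc (Suc i) then symbol_at_head (\<sigma>2 4) \<noteq> Blank else ready \<sigma>2 (take (Suc i) z)"
    "\<sigma>2 0 = \<sigma>1 0" "\<sigma>2 (5 + K) = \<sigma>1 (5 + K)"
    using found by (elim exE conjE) (rule that; assumption)
  have sc: "scanned \<sigma>2 z (Suc i)" using \<sigma>1(2) \<sigma>2(3,4) by (simp add: scanned_def)
  have ac: "runs (advance ;; check Ms) \<sigma> (\<not> ?esc (Suc i)) \<sigma>2 (4 + ?c + 2)"
    by (rule runs_seq[OF machine_advance mach(1) \<sigma>1(1) \<sigma>2(1) order_refl])
  have body: "runs ?body \<sigma> (\<not> ?esc (Suc i)) \<sigma>2 (1 + (4 + ?c + 2) + 2)"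
    by (rule runs_branch[OF _ _ _ a _ order_refl])
      (use ac mach(1) in \<open>auto intro!: machine_seq machine_advance machine_test\<close>)
  have cb: "1 + (4 + ?c + 2) + 2 + 1 \<le> ?b" by (simp add: algebra_simps)
  have split: "(\<exists>j. i < j \<and> j \<le> ?n \<and> ?esc j) \<longleftrightarrow> ?esc (Suc i) \<or> (\<exists>j. Suc i < j \<and> j \<le> ?n \<and> ?esc j)"
    using i by (metis Suc_leI Suc_lessI lessI less_imp_le_nat Suc_lessD)
  have Suc_diff: "?n - i = Suc (?n - Suc i)" using i by simp
  have time: "?b + (?n - Suc i + 1) * ?b \<le> t" using Suc(5) unfolding Suc_diff by simp
  show ?case
  proof (cases "?esc (Suc i)")
    case True
    have "runs (scan Ms) \<sigma> True \<sigma>2 (1 + (4 + ?c + 2) + 2)"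
      using body True unfolding scan_def by (intro runs_loop_exit) simp
    then have "runs (scan Ms) \<sigma> True \<sigma>2 t" by (rule runs_mono) (use cb time in linarith)
    then show ?thesis using sc True \<sigma>2(2) split by auto
  next
    case False
    then have rd: "ready \<sigma>2 (take (Suc i) z)" using \<sigma>2(2) by simp
    have "m = ?n - Suc i" using Suc(2) by simp
    from Suc(1)[OF this sc rd order_refl] obtain \<sigma>' k where
      \<sigma>': "runs (scan Ms) \<sigma>2 True \<sigma>' ((?n - Suc i + 1) * ?b)" "scanned \<sigma>' z k"
      "symbol_at_head (\<sigma>' 4) \<noteq> Blank \<longleftrightarrow> (\<exists>j. Suc i < j \<and> j \<le> ?n \<and> ?esc j)" by (elim exE conjE) (rule that; assumption)
    have again: "runs ?body \<sigma> True \<sigma>2 (1 + (4 + ?c + 2) + 2)"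
      using body by (simp only: False not_False_eq_True)
    have "1 + (4 + ?c + 2) + 2 + (?n - Suc i + 1) * ?b + 1 \<le> t" using cb time by linarith
    then have "runs (scan Ms) \<sigma> True \<sigma>' t" unfolding scan_def
      by (rule runs_loop_again[OF mach(2) again \<sigma>'(1)[unfolded scan_def]])
    then show ?thesis using \<sigma>'(2,3) False split by blast
  qed
qed

text \<open>
  The diagonal function is the identity on its domain, and the output tape already holds the examined
  part of the input. So on acceptance the rest of the input is copied.
\<close>

definition decide :: "nat tm list \<Rightarrow> nat tm" where
  "decide Ms = scan Ms ;; branch (test (\<lambda>r. r 4 \<noteq> Blank))
     (sweep (\<lambda>r. r 0 \<noteq> Blank) (\<lambda>r. (idle r)(0 := (r 0, MoveRight), 5 + K := (r 0, MoveRight)))) fail"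

lemma machine_decide: "list_all2 (realizes T) Ms gs \<Longrightarrow> machine (decide Ms)"
  unfolding decide_def by (intro machine_rules machine_scan machine_branch)

text \<open>
  The empty prefix contains no instruction, so the loop over the prefixes may begin with the first letter.
\<close>

lemma escape_Nil: "\<not> escape gs B [] d"
proof -
  have "decode gs [] = None" by (cases gs) auto
  then show ?thesis by (simp add: escape.simps)
qed

lemma diagonal_altdef:
  "diagonal gs z = (if \<exists>j. 0 < j \<and> j \<le> length z \<and> escape gs (2 * j) (take j z) (take j z) then Some z else None)"
proof -
  have "(\<exists>x. prefix x z \<and> escape gs (2 * length x) x x)
      \<longleftrightarrow> (\<exists>j. 0 < j \<and> j \<le> length z \<and> escape gs (2 * j) (take j z) (take j z))"
  proof
    assume "\<exists>x. prefix x z \<and> escape gs (2 * length x) x x"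
    then obtain x where x: "prefix x z" "escape gs (2 * length x) x x" by blast
    then have "x \<noteq> []" using escape_Nil by auto
    with x show "\<exists>j. 0 < j \<and> j \<le> length z \<and> escape gs (2 * j) (take j z) (take j z)"
      by (intro exI[of _ "length x"]) (auto simp: prefix_def)
  next
    assume "\<exists>j. 0 < j \<and> j \<le> length z \<and> escape gs (2 * j) (take j z) (take j z)"
    then obtain j where j: "j \<le> length z" "escape gs (2 * j) (take j z) (take j z)" by blast
    then have "length (take j z) = j" by simp
    with j show "\<exists>x. prefix x z \<and> escape gs (2 * length x) x x"
      by (intro exI[of _ "take j z"]) (simp only: take_is_prefix)
  qed
  then show ?thesis by (simp add: diagonal_def)
qed

lemma decide_computes_diagonal:
  assumes real: "list_all2 (realizes T) Ms gs" and T: "mono T"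
  shows "computes_in_time (decide Ms)
    (\<lambda>n. (n + 2) * ((n + 3) * (20 * (T (2 * n) + 2 * n + length Ms) + 300))) (diagonal gs)"
  unfolding computes_in_time_def
proof
  fix z :: word
  let ?n = "length z"
  let ?b = "(?n + 3) * (20 * (T (2 * ?n) + 2 * ?n + length Ms) + 300)"
  let ?F = "sweep (\<lambda>r. r 0 \<noteq> Blank) (\<lambda>r. (idle r)(0 := (r 0, MoveRight), 5 + K := (r 0, MoveRight)))"
  let ?E = "branch (test (\<lambda>r. r 4 \<noteq> Blank)) ?F fail"
  obtain \<sigma> :: tapes where \<sigma>_def: "\<sigma> = (\<lambda>j. if j = 0 then tp 0 z else tp 0 [])" by simp
  have mach: "machine (scan Ms)" "machine ?F" "machine ?E" "machine (decide Ms)"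
    using real by (auto intro!: machine_scan machine_rules machine_branch machine_decide)
  have init: "init_config (decide Ms) z = (start (decide Ms), map \<sigma> [0..<N])"
  proof -
    have "ntapes (decide Ms) = N" using mach(4) by (simp add: machine_def)
    moreover have "map \<sigma> [0..<N] = (0, word_contents z) # replicate (N - 1) (0, word_contents [])"
      using N by (intro nth_equalityI) (auto simp: \<sigma>_def tp_def nth_Cons' simp del: upt_Suc)
    ultimately show ?thesis by (simp add: init_config_def)
  qed
  have "scanned \<sigma> z 0" "ready \<sigma> (take 0 z)"
    by (auto simp: \<sigma>_def scanned_def ready_def clean_def on_bank_def word_contents_Nil)
  from runs_scan[OF real T this, of "(?n + 1) * ?b"] obtain \<sigma>1 k where
    \<sigma>1: "runs (scan Ms) \<sigma> True \<sigma>1 ((?n + 1) * ?b)" and sc: "scanned \<sigma>1 z k"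
    and flag: "symbol_at_head (\<sigma>1 4) \<noteq> Blank \<longleftrightarrow>
       (\<exists>j. 0 < j \<and> j \<le> ?n \<and> escape gs (2 * j) (take j z) (take j z))" by auto
  have s: "k \<le> ?n" "\<sigma>1 0 = tp (int k) z" "\<sigma>1 (5 + K) = tp (int k) (take k z)"
    using sc by (auto simp: scanned_def)
  have "\<exists>\<sigma>2. runs ?E \<sigma>1 (diagonal gs z \<noteq> None) \<sigma>2 (?n + 4) \<and>
     (diagonal gs z \<noteq> None \<longrightarrow> snd (\<sigma>2 (5 + K)) = word_contents z)"
  proof (cases "diagonal gs z")
    case None
    then have "symbol_at_head (\<sigma>1 4) = Blank" using flag by (auto simp: diagonal_altdef split: if_splits)
    then have a: "runs (test (\<lambda>r. r 4 \<noteq> Blank)) \<sigma>1 False \<sigma>1 1"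
      by (intro runs_test_eq) (simp add: visible_def)
    have "runs ?E \<sigma>1 False \<sigma>1 (?n + 4)"
      by (rule runs_branch[OF machine_test mach(2) machine_test a, where ?t2.0 = 1]) (auto intro: runs_fail)
    then show ?thesis using None by auto
  next
    case (Some y)
    then have "symbol_at_head (\<sigma>1 4) \<noteq> Blank" using flag by (auto simp: diagonal_altdef split: if_splits)
    then have a: "runs (test (\<lambda>r. r 4 \<noteq> Blank)) \<sigma>1 True \<sigma>1 1"
      by (intro runs_test_eq) (simp add: visible_def)
    let ?\<tau> = "\<lambda>i. \<sigma>1(0 := tp (int (k + i)) z, 5 + K := tp (int (k + i)) (take (k + i) z))"
    have K: "5 + K < N" by (simp add: N_eq)
    have letter: "act (Letter (z ! (k + i)), MoveRight) (tp (int (k + i)) (take (k + i) z))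
        = tp (int (Suc (k + i))) (take (Suc (k + i)) z)" if "k + i < ?n" for i
      using act_snoc[of "z ! (k + i)" "take (k + i) z"] that
      by (simp add: take_Suc_conv_app_nth del: act.simps of_nat_add)
    have "runs ?F (?\<tau> 0) True (?\<tau> (?n - k)) (?n + 1)"
    proof (rule runs_sweep)
      fix i assume "i < ?n - k"
      then have i: "k + i < ?n" by simp
      show "visible (?\<tau> i) 0 \<noteq> Blank \<and>
        perform (\<lambda>r. (idle r)(0 := (r 0, MoveRight), 5 + K := (r 0, MoveRight))) (?\<tau> i) = ?\<tau> (Suc i)"
        using K i letter[OF i] by (auto simp: tape_simps add.commute simp del: act.simps of_nat_add)
    qed (use s K in \<open>auto simp: visible_def simp del: of_nat_add\<close>)
    moreover have "?\<tau> 0 = \<sigma>1" using s by auto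
    ultimately have f: "runs ?F \<sigma>1 True (?\<tau> (?n - k)) (?n + 1)" by simp
    have "runs ?E \<sigma>1 True (?\<tau> (?n - k)) (?n + 4)"
      by (rule runs_branch[OF machine_test mach(2) machine_test a, where ?t2.0 = "?n + 1"]) (use f in auto)
    moreover have "snd (?\<tau> (?n - k) (5 + K)) = word_contents z" using s(1) by simp
    moreover have "(diagonal gs z \<noteq> None) = True" using Some by simp
    ultimately show ?thesis by (intro exI[of _ "?\<tau> (?n - k)"] conjI impI) (simp_all only:)
  qed
  then obtain \<sigma>2 where \<sigma>2: "runs ?E \<sigma>1 (diagonal gs z \<noteq> None) \<sigma>2 (?n + 4)"
    "diagonal gs z \<noteq> None \<longrightarrow> snd (\<sigma>2 (5 + K)) = word_contents z" by blast
  have "?n + 6 \<le> ?b" by (simp add: algebra_simps)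
  then have time: "(?n + 1) * ?b + (?n + 4) + 2 \<le> (?n + 2) * ?b" by simp
  have "runs (decide Ms) \<sigma> (diagonal gs z \<noteq> None) \<sigma>2 ((?n + 2) * ?b)" unfolding decide_def
    by (rule runs_seq[OF mach(1,3) \<sigma>1 \<sigma>2(1) time])
  then have fin: "(step (decide Ms) ^^ ((?n + 2) * ?b)) (init_config (decide Ms) z)
      = (if diagonal gs z \<noteq> None then accept (decide Ms) else reject (decide Ms), map \<sigma>2 [0..<N])"
    by (simp only: runs_def init)
  have last: "last (map \<sigma>2 [0..<N]) = \<sigma>2 (5 + K)"
    using N by (subst last_map) (auto simp: N_eq)
  have dia: "diagonal gs z = Some y \<Longrightarrow> y = z" for y by (auto simp: diagonal_def split: if_splits)
  show "\<exists>t\<le>(?n + 2) * ?b. case (step (decide Ms) ^^ t) (init_config (decide Ms) z) of (q, ts) \<Rightarrow>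
      (case diagonal gs z of None \<Rightarrow> q = reject (decide Ms)
       | Some y \<Rightarrow> q = accept (decide Ms) \<and> snd (last ts) = word_contents y)"
    by (rule exI[of _ "(?n + 2) * ?b"], unfold fin prod.case last)
      (use \<sigma>2(2) dia in \<open>auto split: option.split\<close>)
qed

end

section \<open>The monoid is not finitely generated\<close>

lemma poly_nat_mono: "mono (poly (p :: nat poly))"
  by (induction p) (auto simp: mono_def intro!: add_mono mult_mono)

text \<open>
  The machines of the generators are brought together: there are enough tapes for each of them, the
  alphabet contains theirs, and a sum of polynomials bounds their running times and the lengths of
  their values.
\<close>

lemma diagonal_polytime_computable:
  assumes "\<And>g. g \<in> set gs \<Longrightarrow> g \<in> fP"
  shows "polytime_computable (diagonal gs)"
proof -
  have "\<exists>(M :: nat tm) p. wf_tm M \<and> computes_in_time M (poly p) g \<and>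
      (\<forall>d y. g d = Some y \<longrightarrow> length y \<le> poly p (length d))" if "g \<in> set gs" for g :: "word \<rightharpoonup> word"
  proof -
    from assms[OF that] obtain M :: "nat tm" and p where M: "wf_tm M" "computes_in_time M (poly p) g"
      by (auto simp: fP_def polytime_computable_def)
    from assms[OF that] obtain q where q: "\<And>d y. g d = Some y \<Longrightarrow> length y \<le> poly q (length d)"
      by (auto simp: fP_def polynomially_balanced_def)
    have "computes_in_time M (poly (p + q)) g" using M(2) by (rule computes_in_time_mono) simp
    moreover have "length y \<le> poly (p + q) (length d)" if "g d = Some y" for d y
      using q[OF that] by simp
    ultimately show ?thesis using M(1) by (intro exI[of _ M] exI[of _ "p + q"]) simp
  qed
  then obtain M :: "_ \<Rightarrow> nat tm" and p :: "_ \<Rightarrow> nat poly" where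
    M: "\<And>g. g \<in> set gs \<Longrightarrow> wf_tm (M g)" "\<And>g. g \<in> set gs \<Longrightarrow> computes_in_time (M g) (poly (p g)) g"
    "\<And>g d y. g \<in> set gs \<Longrightarrow> g d = Some y \<Longrightarrow> length y \<le> poly (p g) (length d)"
    by metis
  define P where "P = (\<Sum>g\<in>set gs. p g)"
  define K where "K = (\<Sum>g\<in>set gs. ntapes (M g))"
  define G where "G = {Blank} \<union> range Letter \<union> (\<Union>g\<in>set gs. alphabet (M g))"
  have le: "poly (p g) n \<le> poly P n" if "g \<in> set gs" for g n
    unfolding P_def poly_sum by (rule member_le_sum[OF that]) auto
  have "finite (range Letter)" by simp
  then have "finite G" unfolding G_def using M(1) by (auto simp: wf_tm_def)
  then interpret simulator "6 + K" G K
    by unfold_locales (auto simp: G_def)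
  have real: "realizes (poly P) (M g) g" if g: "g \<in> set gs" for g
    unfolding realizes_def admissible_def
  proof (intro conjI allI impI)
    show "wf_tm (M g)" using M(1) g .
    show "ntapes (M g) \<le> K" unfolding K_def by (rule member_le_sum[OF g]) auto
    show "alphabet (M g) \<subseteq> G" using g by (auto simp: G_def)
    show "computes_in_time (M g) (poly P) g" using M(2)[OF g] le[OF g] by (rule computes_in_time_mono)
    show "length y \<le> poly P (length d)" if "g d = Some y" for d y
      using M(3)[OF g that] le[OF g] by (rule order_trans)
  qed
  have "list_all2 (realizes (poly P)) (map M gs) gs"
    using real by (auto simp: list_all2_conv_all_nth)
  note dec = machine_decide[OF this] decide_computes_diagonal[OF this poly_nat_mono]
  \<comment> \<open>The time bound of \<open>decide_computes_diagonal\<close>, written as a polynomial.\<close>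
  let ?B = "[:2, 1:] * ([:3, 1:] * ([:20:] * (pcompose P [:0, 2:] + [:length gs, 2:]) + [:300:]))"
  have "computes_in_time (decide (map M gs)) (poly ?B) (diagonal gs)"
    using dec(2) by (rule computes_in_time_mono) (simp add: poly_pcompose algebra_simps mult_2 mult_2_right)
  then show ?thesis using dec(1) unfolding polytime_computable_def machine_def by blast
qed

theorem theorem3p1:
  shows "\<not> finitely_generated_monoid RM2P"
proof
  assume "finitely_generated_monoid RM2P"
  then obtain S where S: "finite S" "S \<subseteq> carrier RM2P" "monoid_generate RM2P S = carrier RM2P"
    by (auto simp: finitely_generated_monoid_def)
  from S(1) obtain gs where gs: "S = set gs" by (metis finite_list)
  have morphism: "g \<in> fP" "right_ideal_morphism g" if "g \<in> set gs" for g
    using S(2) that by (auto simp: gs RM2P_def)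
  have "diagonal gs \<in> carrier RM2P"
    using diagonal_polytime_computable[OF morphism(1)] diagonal_polynomially_balanced
      diagonal_right_ideal_morphism by (auto simp: RM2P_def fP_def)
  then have "diagonal gs \<in> monoid_generate RM2P (set gs)" using S(3) gs by simp
  from monoid_generate_RM2P_pipeline[OF this] diagonal_not_pipeline[OF _ morphism(2)]
  show False by blast
qed

end
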